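(* The set of R-minor valuated matroids forms a complete class of valuated matroids; that is, the class of R-minor valuated matroids is closed under restriction, duals, direct sum and principal extension.
   Context: All ground sets are finite; a maximum over the empty set is $-\infty$. Valuated matroid of rank $d$ on $V$: a function $f\colon\binom{V}{d}\to\mathbb{R}\cup\{-\infty\}$ such that for all $X,Y\in\binom{V}{d}$ and $i\in X\setminus Y$, $f(X)+f(Y)\le\max_{j\in Y\setminus X}\{f(X-i+j)+f(Y+i-j)\}$. Operations: - Restriction to $V\setminus Y$: the restriction of $f$ to $\binom{V\setminus Y}{d}$. - Dual: $f^*(X)=f(V\setminus X)$ for $X\in\binom{V}{|V|-d}$. - Direct sum of $f_1,f_2$ of ranks $d_1,d_2$ on disjoint $V_1,V_2$: $(f_1\oplus f_2)(X)=f_1(X\cap V_1)+f_2(X\cap V_2)$ for $X\in\binom{V_1\cup V_2}{d_1+d_2}$ with $|X\cap V_1|=d_1$, $|X\cap V_2|=d_2$, and $-\infty$ otherwise. - Principal extension by $w\in(\mathbb{R}\cup\{-\infty\})^V$: the function $f^w$ on $\binom{V\cup\{p\}}{d}$, $p$ a new element, with $f^w(X)=f(X)$ for $X\in\binom{V}{d}$ and $f^w(X\cup p)=\max_{v\in V\setminus X}(f(X\cup v)+w_v)$ for $X\in\binom{V}{d-1}$. R-minor valuated matroid: $f\colon\binom{V}{d}\to\mathbb{R}\cup\{-\infty\}$ is R-minor if there exist a finite set $W$ disjoint from $V$ (possibly empty), a bipartite graph $G=(V\cup W,U;E)$ with edge weights $c\in\mathbb{R}^E$, and a matroid $\mathcal{M}$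 on $U$ of rank $d+|W|$ such that for every $X\in\binom{V}{d}$, $f(X)$ is the maximum weight of a matching in $G$ whose set of endpoints in $V\cup W$ is exactly $X\cup W$ and whose set of endpoints in $U$ is a basis of $\mathcal{M}$ ($-\infty$ if there is none). *)

theory Defs
  imports "HOL-Library.Extended_Real" "HOL-Library.FuncSet" "HOL-Library.Ramsey"
begin

text \<open>
  A function from the \<open>d\<close>-subsets of \<open>V\<close> to \<open>\<real> \<union> {-\<infinity>}\<close> is given by
  a total function \<open>f :: 'a set \<Rightarrow> ereal\<close> together with \<open>V\<close> and \<open>d\<close>; only its values on
  \<open>nsets V d = {X. X \<subseteq> V \<and> finite X \<and> card X = d}\<close> matter.
  All maxima range over finite sets and are written as suprema in \<open>ereal\<close>; thus a maximum
  over a nonempty set is attained, and over the empty set it is \<open>bot = -\<infinity>\<close>.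
\<close>

definition valuated_matroid :: "'a set \<Rightarrow> nat \<Rightarrow> ('a set \<Rightarrow> ereal) \<Rightarrow> bool" where
  "valuated_matroid V d f \<longleftrightarrow>
     finite V \<and>
     (\<forall>X\<in>nsets V d. f X \<noteq> \<infinity>) \<and>
     (\<forall>X\<in>nsets V d. \<forall>Y\<in>nsets V d. \<forall>i\<in>X - Y.
        f X + f Y \<le> (SUP j\<in>Y - X. f (insert j (X - {i})) + f (insert i (Y - {j}))))"

definition vm_restriction :: "'a set \<Rightarrow> nat \<Rightarrow> ('a set \<Rightarrow> ereal) \<Rightarrow> 'a set \<Rightarrow> ('a set \<Rightarrow> ereal)" where
  "vm_restriction V d f Y = restrict f (nsets (V - Y) d)"

definition vm_dual :: "'a set \<Rightarrow> ('a set \<Rightarrow> ereal) \<Rightarrow> ('a set \<Rightarrow> ereal)" where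
  "vm_dual V f = (\<lambda>X. f (V - X))"

definition vm_direct_sum ::
    "'a set \<Rightarrow> nat \<Rightarrow> ('a set \<Rightarrow> ereal) \<Rightarrow> 'a set \<Rightarrow> nat \<Rightarrow> ('a set \<Rightarrow> ereal) \<Rightarrow> ('a set \<Rightarrow> ereal)" where
  "vm_direct_sum V1 d1 f1 V2 d2 f2 =
     (\<lambda>X. if card (X \<inter> V1) = d1 \<and> card (X \<inter> V2) = d2 then f1 (X \<inter> V1) + f2 (X \<inter> V2) else -\<infinity>)"

definition principal_extension ::
    "'a set \<Rightarrow> ('a set \<Rightarrow> ereal) \<Rightarrow> ('a \<Rightarrow> ereal) \<Rightarrow> 'a \<Rightarrow> ('a set \<Rightarrow> ereal)" where
  "principal_extension V f w p =
     (\<lambda>X. if p \<in> X then (SUP v\<in>V - (X - {p}). f (insert v (X - {p})) + w v) else f X)"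

text \<open>
  A class of such functions is a predicate on triples \<open>V d f\<close>. The hypothesis
  \<open>d \<le> card V\<close> in the clause for duals keeps the rank \<open>card V - d\<close> from being truncated.
\<close>

definition complete_class ::
    "('a set \<Rightarrow> nat \<Rightarrow> ('a set \<Rightarrow> ereal) \<Rightarrow> bool) \<Rightarrow> bool" where
  "complete_class C \<longleftrightarrow>
     (\<forall>V d f. C V d f \<longrightarrow> valuated_matroid V d f) \<and>
     (\<forall>V d f Y. C V d f \<and> Y \<subseteq> V \<longrightarrow> C (V - Y) d (vm_restriction V d f Y)) \<and>
     (\<forall>V d f. C V d f \<and> d \<le> card V \<longrightarrow> C V (card V - d) (vm_dual V f)) \<and>
     (\<forall>V1 d1 f1 V2 d2 f2. C V1 d1 f1 \<and> C V2 d2 f2 \<and> V1 \<inter> V2 = {} \<longrightarrow>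
        C (V1 \<union> V2) (d1 + d2) (vm_direct_sum V1 d1 f1 V2 d2 f2)) \<and>
     (\<forall>V d f w p. C V d f \<and> (\<forall>v\<in>V. w v \<noteq> \<infinity>) \<and> p \<notin> V \<longrightarrow>
        C (insert p V) d (principal_extension V f w p))"

definition matroid_with_bases :: "'u set \<Rightarrow> nat \<Rightarrow> 'u set set \<Rightarrow> bool" where
  "matroid_with_bases U r \<B> \<longleftrightarrow>
     finite U \<and> \<B> \<noteq> {} \<and>
     (\<forall>B\<in>\<B>. B \<subseteq> U \<and> card B = r) \<and>
     (\<forall>B1\<in>\<B>. \<forall>B2\<in>\<B>. \<forall>x\<in>B1 - B2. \<exists>y\<in>B2 - B1. insert y (B1 - {x}) \<in> \<B>)"

text \<open>
  A bipartite graph with parts \<open>L\<close>, \<open>U\<close> is given by its edge set \<open>E \<subseteq> L \<times> U\<close>; the two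
  components of an edge are its endpoints in \<open>L\<close> and in \<open>U\<close>.
\<close>

definition matching :: "('l \<times> 'u) set \<Rightarrow> ('l \<times> 'u) set \<Rightarrow> bool" where
  "matching E N \<longleftrightarrow> N \<subseteq> E \<and> (\<forall>e\<in>N. \<forall>e'\<in>N. e \<noteq> e' \<longrightarrow> fst e \<noteq> fst e' \<and> snd e \<noteq> snd e')"

text \<open>
  The disjoint union of \<open>V\<close> and \<open>W\<close> is \<open>V <+> W\<close>. Taking \<open>W\<close> and \<open>U\<close> among the
  finite sets of naturals is no restriction, since every finite set is in bijection with one.
\<close>

definition r_minor :: "'a set \<Rightarrow> nat \<Rightarrow> ('a set \<Rightarrow> ereal) \<Rightarrow> bool" where
  "r_minor V d f \<longleftrightarrow>
     finite V \<and>
     (\<exists>(W :: nat set) (U :: nat set) (E :: (('a + nat) \<times> nat) set)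
        (c :: ('a + nat) \<times> nat \<Rightarrow> real) (\<B> :: nat set set).
        finite W \<and>
        E \<subseteq> (V <+> W) \<times> U \<and>
        matroid_with_bases U (d + card W) \<B> \<and>
        (\<forall>X\<in>nsets V d.
           f X = (SUP N\<in>{N. matching E N \<and> fst ` N = X <+> W \<and> snd ` N \<in> \<B>}. ereal (\<Sum>e\<in>N. c e))))"

end

theory Submission
  imports Defs
begin

text \<open>
  Two things have to be shown: an R-minor function satisfies the exchange axiom, and each of the
  four operations can be simulated by a new graph and a new matroid.

  \<^bold>\<open>Exchange.\<close> Fix a bipartite graph with edge set \<open>E\<close>. Weighting every edge set that is mapped
  bijectively onto a basis by its total cost gives a valuated matroid on \<open>E\<close>: the matroid with
  parallel elements, shifted by a linear function. This rests on the symmetric exchange property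
  of bases (lemma \<open>symmetric_basis_exchange\<close>). The maximum weight of a matching with a prescribed
  set of left endpoints arises from it by identifying all edges that share their left endpoint,
  where the new value of a set is the maximum over its transversal preimages. The heart of the
  proof is that such an identification preserves the exchange axiom
  (\<open>valuated_matroid_aggregate\<close>). Identifying many elements at once is awkward, because a chain of
  exchanges could cycle; identifying only two elements at a time, a chain has at most three links,
  and identifications compose. Finally, fixing the part \<open>W\<close> of the left endpoints is a
  contraction, which is harmless.

  \<^bold>\<open>Operations.\<close> All constructions use the same device. An element \<open>x\<close> which should be either
  used by one side or by the other is doubled: one copy becomes a contracted left vertex, which
  has to be matched, and one copy becomes a coloop on the right, which has to be covered.
  For the dual, the right vertices \<open>u\<close> of the old graph become contracted left vertices, which are
  matched either with their own copy in the dual matroid, when they lie outside the basis, or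
  backwards along an old edge to a copy of a left vertex. For principal extensions, the elements of
  \<open>V\<close> become an intermediate layer between \<open>V \<union> {p}\<close> and the old graph; more generally the class is
  closed under induction through any weighted bipartite graph (\<open>r_minor_induction\<close>), and a
  principal extension is the special case with edges \<open>(v, v)\<close> of weight \<open>0\<close> and \<open>(p, v)\<close> of weight
  \<open>w v\<close>. Direct sums are disjoint unions, and restrictions delete vertices.
\<close>

section \<open>Symmetric exchange of bases\<close>

lemma matroid_with_bases_exchange:
  assumes "matroid_with_bases U r \<B>" "B1 \<in> \<B>" "B2 \<in> \<B>" "x \<in> B1 - B2"
  obtains y where "y \<in> B2 - B1" "insert y (B1 - {x}) \<in> \<B>"
proof -
  have "\<forall>B1\<in>\<B>. \<forall>B2\<in>\<B>. \<forall>x\<in>B1 - B2. \<exists>y\<in>B2 - B1. insert y (B1 - {x}) \<in> \<B>"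
    using assms(1) by (simp add: matroid_with_bases_def)
  then have "\<exists>y\<in>B2 - B1. insert y (B1 - {x}) \<in> \<B>" using assms(2-4) by (elim ballE) auto
  then show ?thesis using that by blast
qed

lemma matroid_with_bases_basis:
  assumes "matroid_with_bases U r \<B>" "B \<in> \<B>"
  shows "B \<subseteq> U" "finite B" "card B = r"
proof -
  have "finite U" "\<forall>B\<in>\<B>. B \<subseteq> U \<and> card B = r"
    using assms(1) by (simp_all add: matroid_with_bases_def)
  then show "B \<subseteq> U" "finite B" "card B = r" using assms(2) by (auto intro: finite_subset)
qed

text \<open>
  Exchanging the elements of \<open>B1\<close> that lie outside \<open>I \<union> B2\<close> one after the other never touches \<open>I\<close>.
  This is the augmentation of an independent set from a basis.
\<close>

lemma basis_extension:
  assumes M: "matroid_with_bases U r \<B>" and B1: "B1 \<in> \<B>" "I \<subseteq> B1" and B2: "B2 \<in> \<B>"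
  shows "\<exists>B\<in>\<B>. I \<subseteq> B \<and> B \<subseteq> I \<union> B2"
  using B1
proof (induction "card (B1 - (I \<union> B2))" arbitrary: B1 rule: less_induct)
  case less
  have fin: "finite B1"
    using matroid_with_bases_basis[OF M less.prems(1)] by simp
  show ?case
  proof (cases "B1 \<subseteq> I \<union> B2")
    case True
    then show ?thesis using less.prems by blast
  next
    case False
    then obtain x where x: "x \<in> B1" "x \<notin> I" "x \<notin> B2" by blast
    then obtain y where y: "y \<in> B2 - B1" "insert y (B1 - {x}) \<in> \<B>"
      using matroid_with_bases_exchange[OF M less.prems(1) B2, of x] by blast
    have "insert y (B1 - {x}) - (I \<union> B2) = B1 - (I \<union> B2) - {x}" using y(1) by auto
    moreover have "card (B1 - (I \<union> B2) - {x}) < card (B1 - (I \<union> B2))"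
      using fin x by (intro card_Diff1_less) auto
    ultimately have "card (insert y (B1 - {x}) - (I \<union> B2)) < card (B1 - (I \<union> B2))" by simp
    moreover have "I \<subseteq> insert y (B1 - {x})" using x less.prems(2) by auto
    ultimately show ?thesis using less.hyps[OF _ y(2)] by simp
  qed
qed

text \<open>
  The elements \<open>y\<close> whose exchange for \<open>x\<close> keeps \<open>B2\<close> a basis form, together with \<open>x\<close>, the fundamental
  circuit of \<open>x\<close> with respect to \<open>B2\<close>. So the set \<open>D\<close> of these \<open>y\<close> lies in a basis, but \<open>D\<close> together
  with \<open>x\<close> does not. Extend \<open>D\<close> by elements of \<open>B1\<close> to a basis \<open>B'\<close>. It cannot contain \<open>x\<close>, and
  exchanging \<open>x\<close> out of \<open>B1\<close> against \<open>B'\<close> brings in an element of \<open>B' - B1\<close>, hence one of \<open>D\<close>.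
\<close>

lemma symmetric_basis_exchange:
  assumes M: "matroid_with_bases U r \<B>" and B: "B1 \<in> \<B>" "B2 \<in> \<B>" and x: "x \<in> B1 - B2"
  shows "\<exists>y\<in>B2 - B1. insert y (B1 - {x}) \<in> \<B> \<and> insert x (B2 - {y}) \<in> \<B>"
proof -
  define D where "D = {y \<in> B2. insert x (B2 - {y}) \<in> \<B>}"
  have ex: "\<exists>y\<in>B' - B1. insert y (B1 - {x}) \<in> \<B>" if "B' \<in> \<B>" "x \<notin> B'" for B'
    using matroid_with_bases_exchange[OF M B(1) that(1), of x] x that(2) by blast
  obtain B' where B': "B' \<in> \<B>" "D \<subseteq> B'" "B' \<subseteq> D \<union> B1"
    using basis_extension[OF M B(2) _ B(1), of D] by (auto simp: D_def)
  have "x \<notin> B'"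
  proof
    assume "x \<in> B'"
    then obtain B3 where B3: "B3 \<in> \<B>" "insert x D \<subseteq> B3" "B3 \<subseteq> insert x D \<union> B2"
      using basis_extension[OF M B'(1) _ B(2), of "insert x D"] B'(2) by blast
    have sub: "B3 \<subseteq> insert x B2" using B3 by (auto simp: D_def)
    have card: "card B3 = card B2" and fin: "finite B2" "finite B3"
      using matroid_with_bases_basis[OF M] B(2) B3(1) by auto
    have "\<not> B2 \<subseteq> B3"
    proof
      assume "B2 \<subseteq> B3"
      then have "insert x B2 \<subseteq> B3" using B3(2) by blast
      then have "card (insert x B2) \<le> card B3" using fin card_mono by blast
      then show False using x fin card by simp
    qed
    then obtain y where y: "y \<in> B2" "y \<notin> B3" by blast
    have "B3 = insert x (B2 - {y})"
    proof (rule card_subset_eq)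
      show "finite (insert x (B2 - {y}))" using fin by simp
      show "B3 \<subseteq> insert x (B2 - {y})" using sub y by blast
      have "card (insert x (B2 - {y})) = Suc (card (B2 - {y}))" using x fin by simp
      also have "\<dots> = card B2" using card_Suc_Diff1[OF fin(1) y(1)] .
      finally show "card B3 = card (insert x (B2 - {y}))" using card by simp
    qed
    then have "y \<in> D" using y B3(1) by (simp add: D_def)
    then show False using y B3(2) by blast
  qed
  then obtain y where "y \<in> B' - B1" "insert y (B1 - {x}) \<in> \<B>" using ex B'(1) by blast
  moreover from this have "y \<in> D" using B'(3) by blast
  ultimately show ?thesis by (auto simp: D_def)
qed

section \<open>Matroid constructions\<close>

lemma matroid_with_bases_finite: "matroid_with_bases U r \<B> \<Longrightarrow> finite U"
  by (simp add: matroid_with_bases_def)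

lemma matroid_with_bases_rank_le:
  assumes "matroid_with_bases U r \<B>"
  shows "r \<le> card U"
proof -
  obtain B where "B \<in> \<B>" using assms by (auto simp: matroid_with_bases_def)
  then show ?thesis
    using matroid_with_bases_basis[OF assms] matroid_with_bases_finite[OF assms] card_mono by metis
qed

lemma matroid_with_bases_free: "finite S \<Longrightarrow> matroid_with_bases S (card S) {S}"
  by (simp add: matroid_with_bases_def)

text \<open>
  Exchange between complements reverses the roles of the two bases, so the one-sided axiom is
  not enough here; the symmetric one is.
\<close>

lemma matroid_with_bases_dual:
  assumes M: "matroid_with_bases U r \<B>"
  shows "matroid_with_bases U (card U - r) ((\<lambda>B. U - B) ` \<B>)"
  unfolding matroid_with_bases_def
proof (intro conjI ballI)
  show "finite U" using M by (simp add: matroid_with_bases_def)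
  show "(\<lambda>B. U - B) ` \<B> \<noteq> {}" using M by (simp add: matroid_with_bases_def)
next
  fix B assume "B \<in> (\<lambda>B. U - B) ` \<B>"
  then obtain B' where B': "B' \<in> \<B>" "B = U - B'" by blast
  then show "B \<subseteq> U" by blast
  show "card B = card U - r"
    using matroid_with_bases_basis[OF M B'(1)] B' by (simp add: card_Diff_subset)
next
  fix B1 B2 x
  assume "B1 \<in> (\<lambda>B. U - B) ` \<B>" "B2 \<in> (\<lambda>B. U - B) ` \<B>" and x: "x \<in> B1 - B2"
  then obtain C1 C2 where C: "C1 \<in> \<B>" "C2 \<in> \<B>" "B1 = U - C1" "B2 = U - C2" by blast
  have sub: "C1 \<subseteq> U" using matroid_with_bases_basis(1)[OF M C(1)] .
  have "x \<in> C2 - C1" using x C by blast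
  then obtain y where y: "y \<in> C1 - C2" "insert x (C1 - {y}) \<in> \<B>"
    using symmetric_basis_exchange[OF M C(2,1)] by blast
  have "insert y (B1 - {x}) = U - insert x (C1 - {y})" using C sub x y by blast
  then show "\<exists>y\<in>B2 - B1. insert y (B1 - {x}) \<in> (\<lambda>B. U - B) ` \<B>"
    using y C sub by (intro bexI[of _ y]) auto
qed

lemma matroid_with_bases_direct_sum:
  assumes M1: "matroid_with_bases U1 r1 \<B>1" and M2: "matroid_with_bases U2 r2 \<B>2"
  shows "matroid_with_bases (U1 <+> U2) (r1 + r2) {B1 <+> B2 |B1 B2. B1 \<in> \<B>1 \<and> B2 \<in> \<B>2}"
  unfolding matroid_with_bases_def
proof (intro conjI ballI)
  show "finite (U1 <+> U2)" using M1 M2 by (simp add: matroid_with_bases_def)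
  show "{B1 <+> B2 |B1 B2. B1 \<in> \<B>1 \<and> B2 \<in> \<B>2} \<noteq> {}"
    using M1 M2 by (auto simp: matroid_with_bases_def)
next
  fix B assume "B \<in> {B1 <+> B2 |B1 B2. B1 \<in> \<B>1 \<and> B2 \<in> \<B>2}"
  then obtain B1 B2 where B: "B = B1 <+> B2" "B1 \<in> \<B>1" "B2 \<in> \<B>2" by blast
  then show "B \<subseteq> U1 <+> U2" "card B = r1 + r2"
    using matroid_with_bases_basis[OF M1 B(2)] matroid_with_bases_basis[OF M2 B(3)]
    by (auto simp: card_Plus)
next
  fix A B x
  assume "A \<in> {B1 <+> B2 |B1 B2. B1 \<in> \<B>1 \<and> B2 \<in> \<B>2}"
    "B \<in> {B1 <+> B2 |B1 B2. B1 \<in> \<B>1 \<and> B2 \<in> \<B>2}" and x: "x \<in> A - B"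
  then obtain A1 A2 B1 B2 where AB: "A = A1 <+> A2" "B = B1 <+> B2"
    "A1 \<in> \<B>1" "A2 \<in> \<B>2" "B1 \<in> \<B>1" "B2 \<in> \<B>2" by blast
  show "\<exists>y\<in>B - A. insert y (A - {x}) \<in> {B1 <+> B2 |B1 B2. B1 \<in> \<B>1 \<and> B2 \<in> \<B>2}"
  proof (cases x)
    case (Inl x1)
    then have "x1 \<in> A1 - B1" using x AB by auto
    then obtain y where y: "y \<in> B1 - A1" "insert y (A1 - {x1}) \<in> \<B>1"
      using matroid_with_bases_exchange[OF M1] AB by metis
    have "insert (Inl y) (A - {x}) = insert y (A1 - {x1}) <+> A2" using AB Inl by auto
    then show ?thesis using y AB by (intro bexI[of _ "Inl y"]) auto
  next
    case (Inr x2)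
    then have "x2 \<in> A2 - B2" using x AB by auto
    then obtain y where y: "y \<in> B2 - A2" "insert y (A2 - {x2}) \<in> \<B>2"
      using matroid_with_bases_exchange[OF M2] AB by metis
    have "insert (Inr y) (A - {x}) = A1 <+> insert y (A2 - {x2})" using AB Inr by auto
    then show ?thesis using y AB by (intro bexI[of _ "Inr y"]) auto
  qed
qed

lemma matroid_with_bases_image:
  assumes M: "matroid_with_bases U r \<B>" and inj: "inj_on h U"
  shows "matroid_with_bases (h ` U) r ((`) h ` \<B>)"
  unfolding matroid_with_bases_def
proof (intro conjI ballI)
  show "finite (h ` U)" using M by (simp add: matroid_with_bases_def)
  show "(`) h ` \<B> \<noteq> {}" using M by (simp add: matroid_with_bases_def)
next
  fix B assume "B \<in> (`) h ` \<B>"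
  then obtain C where C: "B = h ` C" "C \<in> \<B>" by blast
  note C' = matroid_with_bases_basis[OF M C(2)]
  show "B \<subseteq> h ` U" using C C' by blast
  show "card B = r" using C C' inj_on_subset[OF inj C'(1)] by (simp add: card_image)
next
  fix B1 B2 x
  assume "B1 \<in> (`) h ` \<B>" "B2 \<in> (`) h ` \<B>" and x: "x \<in> B1 - B2"
  then obtain C1 C2 x' where C: "C1 \<in> \<B>" "C2 \<in> \<B>" "B1 = h ` C1" "B2 = h ` C2"
    "x' \<in> C1 - C2" "x = h x'" by auto
  obtain y where y: "y \<in> C2 - C1" "insert y (C1 - {x'}) \<in> \<B>"
    using matroid_with_bases_exchange[OF M C(1,2,5)] .
  have sub: "C1 \<subseteq> U" "C2 \<subseteq> U" using matroid_with_bases_basis(1)[OF M] C by auto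
  have "h ` (C1 - {x'}) = B1 - {x}"
    using inj_on_image_set_diff[OF inj, of C1 "{x'}"] sub C by auto
  then have "insert (h y) (B1 - {x}) = h ` insert y (C1 - {x'})" by simp
  then have "insert (h y) (B1 - {x}) \<in> (`) h ` \<B>" using y(2) by blast
  moreover have "h y \<in> B2 - B1"
    using y(1) sub C(3,4) inj_on_image_mem_iff[OF inj, of y C1] by auto
  ultimately show "\<exists>y\<in>B2 - B1. insert y (B1 - {x}) \<in> (`) h ` \<B>" by blast
qed

section \<open>Aggregation of valuated matroids\<close>

lemma SUP_finite_attained:
  fixes g :: "'b \<Rightarrow> ereal"
  assumes "finite A" "(SUP x\<in>A. g x) \<noteq> -\<infinity>"
  shows "\<exists>x\<in>A. (SUP x\<in>A. g x) = g x"
proof -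
  have "A \<noteq> {}" using assms(2) by (auto simp: bot_ereal_def)
  then have "Sup (g ` A) = Max (g ` A)" using assms(1) by (simp add: Max_Sup)
  moreover have "Max (g ` A) \<in> g ` A" using assms(1) \<open>A \<noteq> {}\<close> by simp
  ultimately show ?thesis by auto
qed

text \<open>
  As values \<open>-\<infinity>\<close> make the exchange inequality trivial and a finite supremum is attained, the axiom
  amounts to the existence of a suitable \<open>j\<close> for pairs of finite value. This and the next lemma are
  the two directions.
\<close>

lemma valuated_matroidI:
  assumes "finite V"
    and "\<And>X. X \<in> nsets V d \<Longrightarrow> f X \<noteq> \<infinity>"
    and "\<And>X Y i. X \<in> nsets V d \<Longrightarrow> Y \<in> nsets V d \<Longrightarrow> i \<in> X - Y \<Longrightarrow> f X \<noteq> -\<infinity> \<Longrightarrow> f Y \<noteq> -\<infinity> \<Longrightarrow>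
      \<exists>j\<in>Y - X. f X + f Y \<le> f (insert j (X - {i})) + f (insert i (Y - {j}))"
  shows "valuated_matroid V d f"
  unfolding valuated_matroid_def
proof (intro conjI ballI)
  fix X Y i assume XY: "X \<in> nsets V d" "Y \<in> nsets V d" "i \<in> X - Y"
  show "f X + f Y \<le> (SUP j\<in>Y - X. f (insert j (X - {i})) + f (insert i (Y - {j})))"
  proof (cases "f X = -\<infinity> \<or> f Y = -\<infinity>")
    case True
    then have "f X + f Y = -\<infinity>" using assms(2)[OF XY(1)] assms(2)[OF XY(2)] by auto
    then show ?thesis by (simp only: ereal_infty_less_eq2 bot_ereal_def[symmetric] bot_least)
  next
    case False
    then obtain j where "j \<in> Y - X"
      "f X + f Y \<le> f (insert j (X - {i})) + f (insert i (Y - {j}))" using assms(3)[OF XY] by blast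
    then show ?thesis by (meson SUP_upper2)
  qed
qed (use assms in auto)

lemma valuated_matroid_exchange:
  assumes f: "valuated_matroid V d f" and XY: "X \<in> nsets V d" "Y \<in> nsets V d" "i \<in> X - Y"
    and fin: "f X \<noteq> -\<infinity>" "f Y \<noteq> -\<infinity>"
  shows "\<exists>j\<in>Y - X. f X + f Y \<le> f (insert j (X - {i})) + f (insert i (Y - {j}))"
proof -
  let ?S = "SUP j\<in>Y - X. f (insert j (X - {i})) + f (insert i (Y - {j}))"
  have le: "f X + f Y \<le> ?S" using f XY unfolding valuated_matroid_def by blast
  have "f X + f Y \<noteq> -\<infinity>" using fin by simp
  then have "?S \<noteq> -\<infinity>" using le by auto
  then obtain j where "j \<in> Y - X" "?S = f (insert j (X - {i})) + f (insert i (Y - {j}))"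
    using SUP_finite_attained[of "Y - X" "\<lambda>j. f (insert j (X - {i})) + f (insert i (Y - {j}))"]
      XY(2) by (auto simp: nsets_def)
  then show ?thesis using le by metis
qed

lemma nsets_exchange:
  assumes "X \<in> nsets V d" "i \<in> X" "j \<in> V" "j \<notin> X"
  shows "insert j (X - {i}) \<in> nsets V d"
proof -
  have "card (insert j (X - {i})) = Suc (card (X - {i}))" using assms by (simp add: nsets_def)
  also have "\<dots> = card X" using assms(1,2) unfolding nsets_def by (blast intro: card_Suc_Diff1)
  finally show ?thesis using assms by (auto simp: nsets_def)
qed

text \<open>
  The valuated matroid obtained by identifying the elements in each fibre of \<open>h\<close>. Sets that contain
  two elements of one fibre are discarded.
\<close>

definition aggregate :: "'e set \<Rightarrow> ('e \<Rightarrow> 'l) \<Rightarrow> ('e set \<Rightarrow> ereal) \<Rightarrow> ('l set \<Rightarrow> ereal)" where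
  "aggregate E h g X = (SUP S\<in>{S. S \<subseteq> E \<and> inj_on h S \<and> h ` S = X}. g S)"

lemma aggregate_upper:
  assumes "S \<subseteq> E" "inj_on h S"
  shows "g S \<le> aggregate E h g (h ` S)"
  unfolding aggregate_def using assms by (intro SUP_upper) auto

lemma aggregate_attained:
  assumes "finite E" "aggregate E h g X \<noteq> -\<infinity>"
  obtains S where "S \<subseteq> E" "inj_on h S" "h ` S = X" "aggregate E h g X = g S"
proof -
  let ?A = "{S. S \<subseteq> E \<and> inj_on h S \<and> h ` S = X}"
  have "finite ?A" using assms(1) by (intro finite_subset[of ?A "Pow E"]) auto
  then have "\<exists>S\<in>?A. aggregate E h g X = g S"
    using SUP_finite_attained[of ?A g] assms(2) by (simp add: aggregate_def)
  then show ?thesis using that by auto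
qed

lemma aggregate_comp:
  "aggregate E (h' \<circ> h) g X = aggregate (h ` E) h' (aggregate E h g) X"
proof (rule antisym)
  show "aggregate E (h' \<circ> h) g X \<le> aggregate (h ` E) h' (aggregate E h g) X"
    unfolding aggregate_def[of E "h' \<circ> h"]
  proof (rule SUP_least)
    fix S assume "S \<in> {S. S \<subseteq> E \<and> inj_on (h' \<circ> h) S \<and> (h' \<circ> h) ` S = X}"
    then have S: "S \<subseteq> E" "inj_on h S" "inj_on h' (h ` S)" "h' ` h ` S = X"
      using comp_inj_on_iff[of h S h'] inj_on_imageI2[of h' h S]
      by (auto simp: image_comp inj_on_imageI)
    have "g S \<le> aggregate E h g (h ` S)" using S by (intro aggregate_upper)
    also have "\<dots> \<le> aggregate (h ` E) h' (aggregate E h g) X"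
      using aggregate_upper[of "h ` S" "h ` E" h'] S by auto
    finally show "g S \<le> aggregate (h ` E) h' (aggregate E h g) X" .
  qed
  show "aggregate (h ` E) h' (aggregate E h g) X \<le> aggregate E (h' \<circ> h) g X"
    unfolding aggregate_def[of "h ` E"] aggregate_def[of E h]
  proof (intro SUP_least)
    fix T S assume "T \<in> {S. S \<subseteq> h ` E \<and> inj_on h' S \<and> h' ` S = X}"
      "S \<in> {S. S \<subseteq> E \<and> inj_on h S \<and> h ` S = T}"
    then have "S \<subseteq> E" "inj_on (h' \<circ> h) S" "(h' \<circ> h) ` S = X" by (auto intro: comp_inj_on)
    then show "g S \<le> aggregate E (h' \<circ> h) g X" using aggregate_upper by metis
  qed
qed

lemma inj_on_exchange:
  assumes "inj_on h S" "e \<in> S" "h u \<notin> h ` S \<or> h u = h e"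
  shows "inj_on h (insert u (S - {e}))" "h ` insert u (S - {e}) = insert (h u) (h ` S - {h e})"
proof -
  have im: "h ` (S - {e}) = h ` S - {h e}"
    using inj_on_image_set_diff[OF assms(1), of S "{e}"] assms(2) by simp
  then have "h u \<notin> h ` (S - {e})" using assms(3) by blast
  moreover have "inj_on h (S - {e})" using assms(1) by (rule inj_on_subset) blast
  ultimately show "inj_on h (insert u (S - {e}))" by auto
  show "h ` insert u (S - {e}) = insert (h u) (h ` S - {h e})" using im by simp
qed

text \<open>
  If exchanging \<open>e\<close> for \<open>u\<close> creates no collision under \<open>h\<close>, then both new sets are transversals
  again, and the exchange descends to the images.
\<close>

lemma aggregate_exchange_step:
  fixes f :: "'l set \<Rightarrow> ereal"
  assumes f: "f = aggregate E h g"
    and S: "S \<subseteq> E" "inj_on h S" "g S = f (h ` S)" "e \<in> S" "h e \<notin> h ` T"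
    and T: "T \<subseteq> E" "inj_on h T" "g T = f (h ` T)" "u \<in> T" "h u \<notin> h ` S"
    and le: "g S + g T \<le> g (insert u (S - {e})) + g (insert e (T - {u}))"
  shows "\<exists>j\<in>h ` T - h ` S. f (h ` S) + f (h ` T) \<le>
    f (insert j (h ` S - {h e})) + f (insert (h e) (h ` T - {j}))"
proof
  show "h u \<in> h ` T - h ` S" using T by blast
  have "g (insert u (S - {e})) \<le> f (insert (h u) (h ` S - {h e}))"
    using aggregate_upper[of "insert u (S - {e})" E h g] inj_on_exchange[of h S e u] S T f by auto
  moreover have "g (insert e (T - {u})) \<le> f (insert (h e) (h ` T - {h u}))"
    using aggregate_upper[of "insert e (T - {u})" E h g] inj_on_exchange[of h T u e] S T f by auto
  ultimately show "f (h ` S) + f (h ` T) \<le>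
      f (insert (h u) (h ` S - {h e})) + f (insert (h e) (h ` T - {h u}))"
    using le unfolding S(3)[symmetric] T(3)[symmetric] by (meson add_mono order_trans)
qed

lemma ereal_add_le_not_MInf:
  fixes a b a' b' :: ereal
  assumes "a + b \<le> a' + b'" "a \<noteq> -\<infinity>" "b \<noteq> -\<infinity>" "a' \<noteq> \<infinity>" "b' \<noteq> \<infinity>"
  shows "a' \<noteq> -\<infinity> \<and> b' \<noteq> -\<infinity>"
  using assms by (cases a; cases b; cases a'; cases b') auto

lemma valuated_matroid_exchange_sets:
  assumes g: "valuated_matroid E d g" and S: "S \<in> nsets E d" "g S \<noteq> -\<infinity>" "e \<in> S - T"
    and T: "T \<in> nsets E d" "g T \<noteq> -\<infinity>"
  obtains u where "u \<in> T - S" "g S + g T \<le> g (insert u (S - {e})) + g (insert e (T - {u}))"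
    "insert u (S - {e}) \<in> nsets E d" "insert e (T - {u}) \<in> nsets E d"
    "g (insert u (S - {e})) \<noteq> -\<infinity>" "g (insert e (T - {u})) \<noteq> -\<infinity>"
proof -
  obtain u where u: "u \<in> T - S" "g S + g T \<le> g (insert u (S - {e})) + g (insert e (T - {u}))"
    using valuated_matroid_exchange[OF g S(1) T(1) S(3) S(2) T(2)] by blast
  have E: "e \<in> E" "u \<in> E" using S T u(1) by (auto simp: nsets_def)
  have PQ: "insert u (S - {e}) \<in> nsets E d" "insert e (T - {u}) \<in> nsets E d"
    using nsets_exchange[OF S(1), of e u] nsets_exchange[OF T(1), of u e] S(3) u(1) E by auto
  have "g (insert u (S - {e})) \<noteq> \<infinity>" "g (insert e (T - {u})) \<noteq> \<infinity>"
    using g PQ by (auto simp: valuated_matroid_def)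
  then have "g (insert u (S - {e})) \<noteq> -\<infinity>" "g (insert e (T - {u})) \<noteq> -\<infinity>"
    using ereal_add_le_not_MInf[OF u(2) S(2) T(2)] by blast+
  then show ?thesis using that u PQ by blast
qed

lemma ereal_add_eq_of_le:
  fixes a b a' b' :: ereal
  assumes "a + b \<le> a' + b'" "a' \<le> a" "b' \<le> b" "a \<noteq> -\<infinity>" "b \<noteq> -\<infinity>" "a \<noteq> \<infinity>" "b \<noteq> \<infinity>"
  shows "a' = a"
  using assms by (cases a; cases b; cases a'; cases b') auto

text \<open>
  Let \<open>S\<close> and \<open>T\<close> be optimal preimages, and suppose that only two elements are identified. Exchange
  \<open>e\<close> for some \<open>u\<close> of \<open>T\<close>. The only obstacle is that the image of \<open>u\<close> is already present in the
  image of \<open>S\<close>; then \<open>u\<close> and some \<open>c\<close> of \<open>S\<close> are the two identified elements. After the exchange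
  the first set contains both of them and the second none, and a second exchange hands \<open>c\<close> over to
  the second set in return for some \<open>k\<close>. If \<open>k\<close> differs from \<open>e\<close>, the two exchanges together are the desired one. If \<open>k = e\<close>,
  their effect is to swap the roles of \<open>c\<close> and \<open>u\<close>, so by optimality \<open>S'\<close>, which is \<open>S\<close> with \<open>u\<close> in
  place of \<open>c\<close>, is an optimal preimage as well. Now \<open>S'\<close> and \<open>T\<close> use the same one of the two
  elements, and exchanging \<open>e\<close> between them cannot collide.
\<close>

lemma aggregate_exchange_pair:
  fixes f :: "'l set \<Rightarrow> ereal"
  assumes g: "valuated_matroid E d g" and f: "f = aggregate E h g"
    and S: "S \<in> nsets E d" "inj_on h S" "g S = f (h ` S)" "g S \<noteq> -\<infinity>" "e \<in> S" "h e \<notin> h ` T"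
    and T: "T \<in> nsets E d" "inj_on h T" "g T = f (h ` T)" "g T \<noteq> -\<infinity>"
    and pair: "\<forall>x\<in>E. \<forall>y\<in>E. x \<noteq> y \<longrightarrow> h x = h y \<longrightarrow> {x, y} = {a, b}"
  shows "\<exists>j\<in>h ` T - h ` S. f (h ` S) + f (h ` T) \<le>
    f (insert j (h ` S - {h e})) + f (insert (h e) (h ` T - {j}))"
proof (rule ccontr)
  assume no: "\<not> ?thesis"
  have sub: "S \<subseteq> E" "T \<subseteq> E" using S T by (auto simp: nsets_def)
  have eT: "e \<in> S - T" using S by blast
  obtain u where u: "u \<in> T - S" and le1: "g S + g T \<le> g (insert u (S - {e})) + g (insert e (T - {u}))"
    and P: "insert u (S - {e}) \<in> nsets E d" "g (insert u (S - {e})) \<noteq> -\<infinity>"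
    and Q: "insert e (T - {u}) \<in> nsets E d" "g (insert e (T - {u})) \<noteq> -\<infinity>"
    using valuated_matroid_exchange_sets[OF g S(1,4) eT T(1,4)] by blast
  have "h u \<in> h ` S"
    using aggregate_exchange_step[OF f sub(1) S(2,3,5,6) sub(2) T(2,3) _ _ le1] u no by blast
  then obtain c where c: "c \<in> S" "h u = h c" by blast
  have cu: "c \<noteq> u" using c u by blast
  have hcT: "h c \<in> h ` T" using u unfolding c(2)[symmetric] by blast
  have ce: "c \<noteq> e" using hcT S(6) by blast
  have cT: "c \<notin> T" using inj_onD[OF T(2) c(2)] cu u by blast
  have other: "{x, y} = {c, u}" if "x \<in> E" "y \<in> E" "x \<noteq> y" "h x = h y" for x y
  proof -
    have "c \<in> E" "u \<in> E" "h c = h u" using c u sub by auto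
    then have "{c, u} = {a, b}" using pair cu by blast
    moreover have "{x, y} = {a, b}" using pair that by blast
    ultimately show ?thesis by simp
  qed
  define S' where "S' = insert u (S - {c})"
  define T' where "T' = insert c (T - {u})"
  have S': "inj_on h S'" "h ` S' = h ` S" "S' \<subseteq> E" "e \<in> S'"
    using inj_on_exchange[OF S(2) c(1), of u] c u sub S(5) ce by (auto simp: S'_def)
  have T': "inj_on h T'" "h ` T' = h ` T" "T' \<subseteq> E"
    using inj_on_exchange[OF T(2), of u c] c u sub hcT by (auto simp: T'_def)
  have "c \<in> insert u (S - {e}) - insert e (T - {u})" using c cT ce by blast
  then obtain k where k: "k \<in> insert e (T - {u}) - insert u (S - {e})"
    and le12: "g (insert u (S - {e})) + g (insert e (T - {u})) \<le>
      g (insert k (insert u (S - {e}) - {c})) + g (insert c (insert e (T - {u}) - {k}))"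
    by (rule valuated_matroid_exchange_sets[OF g P _ Q])
  have le2: "g S + g T \<le>
      g (insert k (insert u (S - {e}) - {c})) + g (insert c (insert e (T - {u}) - {k}))"
    using le1 le12 by (rule order_trans)
  have swaps: "g S' \<le> g S" "g T' \<le> g T"
    using aggregate_upper[OF S'(3,1), of g] aggregate_upper[OF T'(3,1), of g]
    unfolding S(3) T(3) S'(2) T'(2) f .
  have inf: "g S \<noteq> \<infinity>" "g T \<noteq> \<infinity>" using g S(1) T(1) by (auto simp: valuated_matroid_def)
  show False
  proof (cases "k = e")
    case True
    have "insert k (insert u (S - {e}) - {c}) = S'" "insert c (insert e (T - {u}) - {k}) = T'"
      using True S(5) u c cu ce eT unfolding S'_def T'_def by auto
    then have "g S + g T \<le> g S' + g T'" using le2 by simp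
    then have gS': "g S' = g S" using swaps S(4) T(4) inf by (intro ereal_add_eq_of_le)
    have nS': "S' \<in> nsets E d"
      using nsets_exchange[OF S(1) c(1), of u] u sub by (auto simp: S'_def)
    have eS': "e \<in> S' - T" using S'(4) eT by blast
    then obtain v where v: "v \<in> T - S'"
      and le3: "g S' + g T \<le> g (insert v (S' - {e})) + g (insert e (T - {v}))"
      using valuated_matroid_exchange_sets[OF g nS' _ eS' T(1,4)] S(4) unfolding gS' by blast
    have "h v \<notin> h ` S'"
    proof
      assume "h v \<in> h ` S'"
      then obtain s where s: "s \<in> S'" "h v = h s" by blast
      then have "{v, s} = {c, u}" using other[of v s] v S'(3) sub by blast
      then show False using v s cT by (auto simp: S'_def)
    qed
    moreover have "g S' = f (h ` S')" using gS' S(3) S'(2) by simp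
    moreover have "v \<in> T" using v by blast
    ultimately show False
      using aggregate_exchange_step[OF f S'(3,1) _ S'(4) S(6) sub(2) T(2,3) _ _ le3] no
      unfolding S'(2) by blast
  next
    case False
    then have kT: "k \<in> T" "k \<noteq> u" "k \<notin> S" using k by auto
    have kS: "h k \<notin> h ` S'"
    proof
      assume "h k \<in> h ` S'"
      then obtain s where s: "s \<in> S" "h k = h s" using S'(2) by auto
      then have "{k, s} = {c, u}" using other[of k s] kT sub by blast
      then show False using kT cT by auto
    qed
    have P': "insert k (insert u (S - {e}) - {c}) = insert k (S' - {e})"
      using u c cu ce S(5) unfolding S'_def by auto
    have Q': "insert c (insert e (T - {u}) - {k}) = insert e (T' - {k})"
      using False kT ce cT unfolding T'_def by auto
    have kT': "k \<in> T'" using kT by (simp add: T'_def)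
    have eT': "h e \<notin> h ` T'" using S(6) T'(2) by simp
    have "g (insert k (S' - {e})) \<le> f (insert (h k) (h ` S - {h e}))"
    proof -
      have "insert k (S' - {e}) \<subseteq> E" using S'(3) kT sub by blast
      then show ?thesis
        using aggregate_upper[of _ E h g] inj_on_exchange[OF S'(1,4), of k] kS
        unfolding f S'(2) by metis
    qed
    moreover have "g (insert e (T' - {k})) \<le> f (insert (h e) (h ` T - {h k}))"
    proof -
      have "insert e (T' - {k}) \<subseteq> E" using T'(3) eT sub by blast
      then show ?thesis
        using aggregate_upper[of _ E h g] inj_on_exchange[OF T'(1) kT', of e] eT'
        unfolding f T'(2) by metis
    qed
    ultimately have "g S + g T \<le> f (insert (h k) (h ` S - {h e})) + f (insert (h e) (h ` T - {h k}))"
      using le2 unfolding P' Q' by (meson add_mono order_trans)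
    moreover have "h k \<in> h ` T - h ` S" using kT kS S'(2) by auto
    ultimately show False using no unfolding S(3) T(3) by blast
  qed
qed

lemma valuated_matroid_aggregate_pair:
  assumes g: "valuated_matroid E d g" and L: "finite L" "h ` E \<subseteq> L"
    and pair: "\<forall>x\<in>E. \<forall>y\<in>E. x \<noteq> y \<longrightarrow> h x = h y \<longrightarrow> {x, y} = {a, b}"
  shows "valuated_matroid L d (aggregate E h g)"
proof (rule valuated_matroidI)
  let ?f = "aggregate E h g"
  have finE: "finite E" using g by (simp add: valuated_matroid_def)
  have attained: "\<exists>S\<in>nsets E d. inj_on h S \<and> h ` S = X \<and> g S = ?f X"
    if X: "X \<in> nsets L d" and nX: "?f X \<noteq> -\<infinity>" for X
  proof -
    obtain S where S: "S \<subseteq> E" "inj_on h S" "h ` S = X" "?f X = g S"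
      using nX by (rule aggregate_attained[OF finE])
    have "card S = card X" using card_image[OF S(2)] S(3) by simp
    then have "S \<in> nsets E d"
      using X S(1) finite_subset[OF S(1) finE] by (simp add: nsets_def)
    then show ?thesis using S(2-4) by (intro bexI[of _ S]) simp_all
  qed
  show "finite L" by fact
  show "?f X \<noteq> \<infinity>" if X: "X \<in> nsets L d" for X
  proof
    assume inf: "?f X = \<infinity>"
    then obtain S where "S \<in> nsets E d" "g S = \<infinity>" using attained[OF X] by auto
    then show False using g by (auto simp: valuated_matroid_def)
  qed
  fix X Y i
  assume X: "X \<in> nsets L d" "?f X \<noteq> -\<infinity>" and Y: "Y \<in> nsets L d" "?f Y \<noteq> -\<infinity>"
    and i: "i \<in> X - Y"
  obtain S where S: "S \<in> nsets E d" "inj_on h S" "h ` S = X" "g S = ?f X"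
    using attained[OF X] by blast
  obtain T where T: "T \<in> nsets E d" "inj_on h T" "h ` T = Y" "g T = ?f Y"
    using attained[OF Y] by blast
  obtain e where e: "e \<in> S" "h e = i" using i S(3) by blast
  show "\<exists>j\<in>Y - X. ?f X + ?f Y \<le> ?f (insert j (X - {i})) + ?f (insert i (Y - {j}))"
  proof -
    have "g S = ?f (h ` S)" "g T = ?f (h ` T)" "g S \<noteq> -\<infinity>" "g T \<noteq> -\<infinity>" "h e \<notin> h ` T"
      using S(3,4) T(3,4) X(2) Y(2) e i by simp_all
    from aggregate_exchange_pair[OF g refl S(1,2) this(1,3) e(1) this(5) T(1,2) this(2,4) pair]
    show ?thesis unfolding S(3) T(3) e(2) .
  qed
qed

text \<open>
  Induction on the number of elements: if \<open>h\<close> is not injective, first identify two elements of a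
  common fibre.
\<close>

lemma valuated_matroid_aggregate:
  fixes h :: "'e \<Rightarrow> 'l"
  assumes "valuated_matroid E d g" "finite L" "h ` E \<subseteq> L"
  shows "valuated_matroid L d (aggregate E h g)"
  using assms
proof (induction "card E" arbitrary: E g rule: less_induct)
  case less
  show ?case
  proof (cases "inj_on h E")
    case True
    \<comment> \<open>no two elements are identified, so the condition on the pair is vacuous\<close>
    then show ?thesis
      by (intro valuated_matroid_aggregate_pair[OF less.prems, of undefined undefined])
        (auto simp: inj_on_def)
  next
    case False
    then obtain a b where ab: "a \<in> E" "b \<in> E" "a \<noteq> b" "h a = h b" by (auto simp: inj_on_def)
    define m where "m = id(b := a)"
    have finE: "finite E" using less.prems by (simp add: valuated_matroid_def)
    have mE: "m ` E = E - {b}" using ab by (auto simp: m_def)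
    have "\<forall>x\<in>E. \<forall>y\<in>E. x \<noteq> y \<longrightarrow> m x = m y \<longrightarrow> {x, y} = {a, b}"
      by (auto simp: m_def)
    then have "valuated_matroid (E - {b}) d (aggregate E m g)"
      using mE finE by (intro valuated_matroid_aggregate_pair[OF less.prems(1)]) auto
    moreover have "card (E - {b}) < card E" using ab(2) finE by (intro card_Diff1_less)
    moreover have "h ` (E - {b}) \<subseteq> L" using less.prems(3) by blast
    ultimately have "valuated_matroid L d (aggregate (E - {b}) h (aggregate E m g))"
      using less.hyps less.prems(2) by blast
    moreover have "aggregate E h g = aggregate (E - {b}) h (aggregate E m g)"
    proof -
      have "h \<circ> m = h" using ab by (auto simp: m_def fun_eq_iff)
      then show ?thesis using aggregate_comp[of E h m g] mE by (intro ext) simp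
    qed
    ultimately show ?thesis by simp
  qed
qed

section \<open>Matchings onto bases\<close>

definition matching_onto :: "('l \<times> 'u) set \<Rightarrow> 'u set set \<Rightarrow> 'l set \<Rightarrow> ('l \<times> 'u) set \<Rightarrow> bool" where
  "matching_onto E \<B> Z N \<longleftrightarrow> N \<subseteq> E \<and> inj_on fst N \<and> inj_on snd N \<and> fst ` N = Z \<and> snd ` N \<in> \<B>"

definition matching_value ::
    "('l \<times> 'u) set \<Rightarrow> ('l \<times> 'u \<Rightarrow> real) \<Rightarrow> 'u set set \<Rightarrow> 'l set \<Rightarrow> ereal" where
  "matching_value E c \<B> Z = (SUP N\<in>{N. matching_onto E \<B> Z N}. ereal (sum c N))"

lemma matching_iff_inj_on: "matching E N \<longleftrightarrow> N \<subseteq> E \<and> inj_on fst N \<and> inj_on snd N"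
  unfolding matching_def inj_on_def by blast

lemma matching_onto_iff:
  "matching_onto E \<B> Z N \<longleftrightarrow> matching E N \<and> fst ` N = Z \<and> snd ` N \<in> \<B>"
  by (auto simp: matching_onto_def matching_iff_inj_on)

lemma matching_value_upper: "matching_onto E \<B> Z N \<Longrightarrow> ereal (sum c N) \<le> matching_value E c \<B> Z"
  unfolding matching_value_def by (intro SUP_upper) simp

lemma matching_value_attained:
  assumes "finite E" "matching_value E c \<B> Z \<noteq> -\<infinity>"
  obtains N where "matching_onto E \<B> Z N" "matching_value E c \<B> Z = ereal (sum c N)"
proof -
  let ?A = "{N. matching_onto E \<B> Z N}"
  have "finite ?A"
    using assms(1) by (intro finite_subset[of ?A "Pow E"]) (auto simp: matching_onto_def)
  then have "\<exists>N\<in>?A. matching_value E c \<B> Z = ereal (sum c N)"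
    using SUP_finite_attained[of ?A "\<lambda>N. ereal (sum c N)"] assms(2) by (simp add: matching_value_def)
  then show ?thesis using that by auto
qed

lemma matching_value_eqI:
  assumes "\<And>N. matching_onto E \<B> Z N \<Longrightarrow> \<exists>N'. matching_onto E' \<B>' Z' N' \<and> sum c' N' = sum c N"
    and "\<And>N'. matching_onto E' \<B>' Z' N' \<Longrightarrow> \<exists>N. matching_onto E \<B> Z N \<and> sum c N = sum c' N'"
  shows "matching_value E c \<B> Z = matching_value E' c' \<B>' Z'"
  unfolding matching_value_def
proof (rule SUP_eq)
  fix N assume "N \<in> {N. matching_onto E \<B> Z N}"
  then show "\<exists>N'\<in>{N. matching_onto E' \<B>' Z' N}. ereal (sum c N) \<le> ereal (sum c' N')"
    using assms(1)[of N] by fastforce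
next
  fix N' assume "N' \<in> {N. matching_onto E' \<B>' Z' N}"
  then show "\<exists>N\<in>{N. matching_onto E \<B> Z N}. ereal (sum c' N') \<le> ereal (sum c N)"
    using assms(2)[of N'] by fastforce
qed

definition basis_weight :: "('l \<times> 'u \<Rightarrow> real) \<Rightarrow> 'u set set \<Rightarrow> ('l \<times> 'u) set \<Rightarrow> ereal" where
  "basis_weight c \<B> S = (if inj_on snd S \<and> snd ` S \<in> \<B> then ereal (sum c S) else -\<infinity>)"

lemma matching_value_eq_aggregate:
  "matching_value E c \<B> Z = aggregate E fst (basis_weight c \<B>) Z"
proof (rule antisym)
  show "matching_value E c \<B> Z \<le> aggregate E fst (basis_weight c \<B>) Z"
    unfolding matching_value_def
  proof (rule SUP_least)
    fix N assume "N \<in> {N. matching_onto E \<B> Z N}"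
    then have N: "N \<subseteq> E" "inj_on fst N" "inj_on snd N" "fst ` N = Z" "snd ` N \<in> \<B>"
      by (simp_all add: matching_onto_def)
    have "ereal (sum c N) = basis_weight c \<B> N" using N by (simp add: basis_weight_def)
    also have "\<dots> \<le> aggregate E fst (basis_weight c \<B>) Z"
      using aggregate_upper[OF N(1,2), of "basis_weight c \<B>"] N(4) by simp
    finally show "ereal (sum c N) \<le> aggregate E fst (basis_weight c \<B>) Z" .
  qed
  show "aggregate E fst (basis_weight c \<B>) Z \<le> matching_value E c \<B> Z"
    unfolding aggregate_def
  proof (rule SUP_least)
    fix S assume S: "S \<in> {S. S \<subseteq> E \<and> inj_on fst S \<and> fst ` S = Z}"
    show "basis_weight c \<B> S \<le> matching_value E c \<B> Z"
    proof (cases "inj_on snd S \<and> snd ` S \<in> \<B>")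
      case True
      then have "matching_onto E \<B> Z S" using S by (simp add: matching_onto_def)
      then show ?thesis using True by (simp add: basis_weight_def matching_value_upper)
    next
      case False
      then have "basis_weight c \<B> S = -\<infinity>" unfolding basis_weight_def by (rule if_not_P)
      then show ?thesis by simp
    qed
  qed
qed

lemma sum_exchange:
  fixes c :: "'e \<Rightarrow> real"
  assumes "finite S" "e \<in> S" "u \<notin> S"
  shows "sum c (insert u (S - {e})) = sum c S - c e + c u"
  using assms by (simp add: sum_diff1)

text \<open>
  Edges with the same right endpoint are parallel elements. If the right endpoint of \<open>e\<close> also occurs
  in \<open>T\<close>, the two parallel edges are swapped; otherwise the symmetric exchange of bases applies.
  In both cases the two edge sets keep their total cost.
\<close>

lemma valuated_matroid_basis_weight:
  assumes E: "finite E" and M: "matroid_with_bases U r \<B>"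
  shows "valuated_matroid E r (basis_weight c \<B>)"
proof (rule valuated_matroidI)
  let ?g = "basis_weight c \<B>"
  show "finite E" by fact
  show "?g S \<noteq> \<infinity>" for S by (simp add: basis_weight_def)
  fix S T e assume ST: "S \<in> nsets E r" "T \<in> nsets E r" and e: "e \<in> S - T"
    and fin: "?g S \<noteq> -\<infinity>" "?g T \<noteq> -\<infinity>"
  have S: "inj_on snd S" "snd ` S \<in> \<B>" and T: "inj_on snd T" "snd ` T \<in> \<B>"
    using fin by (auto simp: basis_weight_def split: if_splits)
  obtain u where u: "u \<in> T" "snd u \<notin> snd ` S \<or> snd u = snd e" "snd e \<notin> snd ` T \<or> snd u = snd e"
    and B: "insert (snd u) (snd ` S - {snd e}) \<in> \<B>" "insert (snd e) (snd ` T - {snd u}) \<in> \<B>"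
  proof (cases "snd e \<in> snd ` T")
    case True
    then obtain u where u: "u \<in> T" "snd u = snd e" by force
    have "insert (snd u) (snd ` S - {snd e}) = snd ` S" "insert (snd e) (snd ` T - {snd u}) = snd ` T"
      using e True unfolding u(2) by blast+
    then show ?thesis using that[of u] u S T by simp
  next
    case False
    then have "snd e \<in> snd ` S - snd ` T" using e by blast
    then obtain y where "y \<in> snd ` T - snd ` S" "insert y (snd ` S - {snd e}) \<in> \<B>"
      "insert (snd e) (snd ` T - {y}) \<in> \<B>"
      using symmetric_basis_exchange[OF M S(2) T(2)] by blast
    then show ?thesis using that False by blast
  qed
  have eS: "e \<in> S" "e \<notin> T" using e by auto
  have "u \<notin> S"
  proof
    assume "u \<in> S"
    then have "u = e" using u(2) inj_onD[OF S(1)] eS(1) by blast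
    then show False using u(1) eS(2) by simp
  qed
  moreover have "?g S + ?g T = ?g (insert u (S - {e})) + ?g (insert e (T - {u}))"
  proof -
    note S' = inj_on_exchange[OF S(1) eS(1) u(2)]
    have T': "inj_on snd (insert e (T - {u}))" "snd ` insert e (T - {u}) = insert (snd e) (snd ` T - {snd u})"
      using inj_on_exchange[OF T(1) u(1), of e] u(3) by auto
    have "sum c (insert u (S - {e})) = sum c S - c e + c u"
      "sum c (insert e (T - {u})) = sum c T - c u + c e"
      using sum_exchange[OF _ eS(1) \<open>u \<notin> S\<close>] sum_exchange[OF _ u(1) eS(2)] ST
      by (simp_all add: nsets_def)
    moreover have "?g (insert u (S - {e})) = ereal (sum c (insert u (S - {e})))"
      using S' B(1) unfolding basis_weight_def by (simp only: if_True simp_thms)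
    moreover have "?g (insert e (T - {u})) = ereal (sum c (insert e (T - {u})))"
      using T' B(2) unfolding basis_weight_def by (simp only: if_True simp_thms)
    ultimately show ?thesis using S T by (simp add: basis_weight_def)
  qed
  ultimately show "\<exists>j\<in>T - S. ?g S + ?g T \<le> ?g (insert j (S - {e})) + ?g (insert e (T - {j}))"
    using u(1) by (intro bexI[of _ u]) auto
qed

theorem valuated_matroid_matching_value:
  assumes "finite L" "E \<subseteq> L \<times> U" "matroid_with_bases U r \<B>"
  shows "valuated_matroid L r (matching_value E c \<B>)"
proof -
  have "finite E"
    using assms matroid_with_bases_finite by (meson finite_SigmaI finite_subset)
  moreover have "fst ` E \<subseteq> L" using assms(2) by auto
  ultimately have "valuated_matroid L r (aggregate E fst (basis_weight c \<B>))"
    using assms by (intro valuated_matroid_aggregate valuated_matroid_basis_weight)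
  moreover have "matching_value E c \<B> = aggregate E fst (basis_weight c \<B>)"
    by (intro ext matching_value_eq_aggregate)
  ultimately show ?thesis by simp
qed

section \<open>Representations of R-minor functions\<close>

text \<open>
  The witnesses in the definition of an R-minor function, over arbitrary types: the constructions
  below live on sum types.
\<close>

definition represents :: "'a set \<Rightarrow> nat \<Rightarrow> ('a set \<Rightarrow> ereal) \<Rightarrow> 'w set \<Rightarrow> 'u set \<Rightarrow>
    (('a + 'w) \<times> 'u) set \<Rightarrow> (('a + 'w) \<times> 'u \<Rightarrow> real) \<Rightarrow> 'u set set \<Rightarrow> bool" where
  "represents V d f W U E c \<B> \<longleftrightarrow> finite V \<and> finite W \<and> E \<subseteq> (V <+> W) \<times> U \<and>
     matroid_with_bases U (d + card W) \<B> \<and> (\<forall>X\<in>nsets V d. f X = matching_value E c \<B> (X <+> W))"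

lemma r_minor_iff_represents:
  "r_minor V d f \<longleftrightarrow> (\<exists>(W :: nat set) (U :: nat set) E c \<B>. represents V d f W U E c \<B>)"
  unfolding r_minor_def represents_def matching_value_def matching_onto_iff by blast

lemma represents_finite_edges:
  assumes "represents V d f W U E c \<B>"
  shows "finite E"
proof (rule finite_subset)
  show "E \<subseteq> (V <+> W) \<times> U" using assms by (simp add: represents_def)
  have "finite U" using assms matroid_with_bases_finite unfolding represents_def by blast
  then show "finite ((V <+> W) \<times> U)" using assms by (simp add: represents_def)
qed

text \<open>
  Contracting \<open>W\<close> keeps the exchange axiom: since \<open>W\<close> lies in both sets, only elements of the other
  summand are ever exchanged.
\<close>

lemma r_minor_valuated_matroid:
  assumes "r_minor V d f"
  shows "valuated_matroid V d f"
proof -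
  obtain W U :: "nat set" and E c \<B> where R: "represents V d f W U E c \<B>"
    using assms unfolding r_minor_iff_represents by blast
  let ?g = "matching_value E c \<B>"
  have fin: "finite V" "finite W" using R by (simp_all add: represents_def)
  have f: "f X = ?g (X <+> W)" if "X \<in> nsets V d" for X using R that by (simp add: represents_def)
  have g: "valuated_matroid (V <+> W) (d + card W) ?g"
    using R by (intro valuated_matroid_matching_value[of _ _ U]) (auto simp: represents_def)
  have ns: "X <+> W \<in> nsets (V <+> W) (d + card W)" if "X \<in> nsets V d" for X
    using that fin by (auto simp: nsets_def card_Plus)
  show ?thesis
  proof (rule valuated_matroidI)
    show "f X \<noteq> \<infinity>" if "X \<in> nsets V d" for X
      using g ns[OF that] unfolding f[OF that] valuated_matroid_def by blast
    fix X Y i assume XY: "X \<in> nsets V d" "Y \<in> nsets V d" and i: "i \<in> X - Y"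
      and nf: "f X \<noteq> -\<infinity>" "f Y \<noteq> -\<infinity>"
    have "Inl i \<in> (X <+> W) - (Y <+> W)" using i by auto
    then obtain j' where j': "j' \<in> (Y <+> W) - (X <+> W)" "?g (X <+> W) + ?g (Y <+> W) \<le>
        ?g (insert j' ((X <+> W) - {Inl i})) + ?g (insert (Inl i) ((Y <+> W) - {j'}))"
      using valuated_matroid_exchange[OF g ns[OF XY(1)] ns[OF XY(2)]] nf f XY by metis
    then obtain j where j: "j' = Inl j" "j \<in> Y - X" by auto
    have "insert j' ((X <+> W) - {Inl i}) = insert j (X - {i}) <+> W"
      "insert (Inl i) ((Y <+> W) - {j'}) = insert i (Y - {j}) <+> W"
      using j(1) by auto
    moreover have "insert j (X - {i}) \<in> nsets V d" "insert i (Y - {j}) \<in> nsets V d"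
      using nsets_exchange[OF XY(1), of i j] nsets_exchange[OF XY(2), of j i] i j(2) XY
      by (auto simp: nsets_def)
    ultimately have "f X + f Y \<le> f (insert j (X - {i})) + f (insert i (Y - {j}))"
      using j'(2) f XY by simp
    then show "\<exists>j\<in>Y - X. f X + f Y \<le> f (insert j (X - {i})) + f (insert i (Y - {j}))"
      using j(2) by blast
  qed (rule fin)
qed

lemma inj_on_map_prod_image:
  assumes N: "N \<subseteq> L \<times> U" and p: "inj_on p L" and q: "inj_on q U"
  shows "inj_on fst (map_prod p q ` N) \<longleftrightarrow> inj_on fst N"
    "inj_on snd (map_prod p q ` N) \<longleftrightarrow> inj_on snd N"
proof -
  have pq: "inj_on (map_prod p q) N"
    using map_prod_inj_on[OF p q] N by (rule inj_on_subset)
  have "fst ` N \<subseteq> L" "snd ` N \<subseteq> U" using N by auto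
  then have "inj_on p (fst ` N)" "inj_on q (snd ` N)"
    using inj_on_subset[OF p] inj_on_subset[OF q] by simp_all
  then have "inj_on (p \<circ> fst) N \<longleftrightarrow> inj_on fst N" "inj_on (q \<circ> snd) N \<longleftrightarrow> inj_on snd N"
    using comp_inj_on[of fst N p] comp_inj_on[of snd N q]
      inj_on_imageI2[of p fst N] inj_on_imageI2[of q snd N] by auto
  moreover have "fst \<circ> map_prod p q = p \<circ> fst" "snd \<circ> map_prod p q = q \<circ> snd"
    by (auto simp: fun_eq_iff)
  ultimately show "inj_on fst (map_prod p q ` N) \<longleftrightarrow> inj_on fst N"
    "inj_on snd (map_prod p q ` N) \<longleftrightarrow> inj_on snd N"
    using comp_inj_on_iff[OF pq, of fst] comp_inj_on_iff[OF pq, of snd] by simp_all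
qed

lemma matching_value_image:
  assumes E: "E \<subseteq> L \<times> U" and p: "inj_on p L" and q: "inj_on q U"
    and Z: "Z \<subseteq> L" and \<B>: "\<And>B. B \<in> \<B> \<Longrightarrow> B \<subseteq> U"
    and c': "\<And>l u. (l, u) \<in> E \<Longrightarrow> c' (p l, q u) = c (l, u)"
  shows "matching_value E c \<B> Z = matching_value (map_prod p q ` E) c' ((`) q ` \<B>) (p ` Z)"
proof -
  let ?h = "map_prod p q"
  have h: "inj_on ?h E" using map_prod_inj_on[OF p q] E by (rule inj_on_subset)
  have key: "matching_onto (?h ` E) ((`) q ` \<B>) (p ` Z) (?h ` N) \<longleftrightarrow> matching_onto E \<B> Z N"
    and wt: "sum c' (?h ` N) = sum c N" if N: "N \<subseteq> E" for N
  proof -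
    have sub: "N \<subseteq> L \<times> U" "fst ` N \<subseteq> L" "snd ` N \<subseteq> U" using N E by auto
    have im: "fst ` ?h ` N = p ` fst ` N" "snd ` ?h ` N = q ` snd ` N"
      by (simp_all add: image_image)
    have "p ` fst ` N = p ` Z \<longleftrightarrow> fst ` N = Z" using inj_on_image_eq_iff[OF p sub(2) Z] .
    moreover have "q ` snd ` N \<in> (`) q ` \<B> \<longleftrightarrow> snd ` N \<in> \<B>"
    proof
      assume "q ` snd ` N \<in> (`) q ` \<B>"
      then obtain B where "B \<in> \<B>" "q ` snd ` N = q ` B" by (rule imageE)
      then show "snd ` N \<in> \<B>" using inj_on_image_eq_iff[OF q sub(3) \<B>] by simp
    qed (rule imageI)
    ultimately show "matching_onto (?h ` E) ((`) q ` \<B>) (p ` Z) (?h ` N) \<longleftrightarrow> matching_onto E \<B> Z N"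
      unfolding matching_onto_def im inj_on_map_prod_image[OF sub(1) p q]
      using N image_mono[OF N, of ?h] by simp
    have "sum c' (?h ` N) = sum (c' \<circ> ?h) N"
      using inj_on_subset[OF h N] by (rule sum.reindex)
    also have "\<dots> = sum c N" using N c' by (intro sum.cong) auto
    finally show "sum c' (?h ` N) = sum c N" .
  qed
  show ?thesis
  proof (rule matching_value_eqI)
    fix N assume N: "matching_onto E \<B> Z N"
    then have "N \<subseteq> E" by (simp add: matching_onto_def)
    then show "\<exists>N'. matching_onto (?h ` E) ((`) q ` \<B>) (p ` Z) N' \<and> sum c' N' = sum c N"
      using key wt N by (intro exI[of _ "?h ` N"]) simp
  next
    fix N' assume N': "matching_onto (?h ` E) ((`) q ` \<B>) (p ` Z) N'"
    then have "N' \<subseteq> ?h ` E" by (simp add: matching_onto_def)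
    then obtain N where N: "N \<subseteq> E" "N' = ?h ` N" by (rule subset_imageE)
    then show "\<exists>N. matching_onto E \<B> Z N \<and> sum c N = sum c' N'"
      using key[OF N(1)] wt[OF N(1)] N' by (intro exI[of _ N]) simp
  qed
qed

lemma represents_imp_r_minor:
  fixes W :: "'w set" and U :: "'u set"
  assumes R: "represents V d f W U E c \<B>"
  shows "r_minor V d f"
proof -
  have fin: "finite V" "finite W" "E \<subseteq> (V <+> W) \<times> U"
    and M: "matroid_with_bases U (d + card W) \<B>"
    and f: "\<And>X. X \<in> nsets V d \<Longrightarrow> f X = matching_value E c \<B> (X <+> W)"
    using R by (simp_all add: represents_def)
  obtain p :: "'w \<Rightarrow> nat" where p: "inj_on p W"
    using finite_imp_inj_to_nat_seg[OF fin(2)] by blast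
  obtain q :: "'u \<Rightarrow> nat" where q: "inj_on q U"
    using finite_imp_inj_to_nat_seg[OF matroid_with_bases_finite[OF M]] by blast
  let ?p = "map_sum id p :: 'a + 'w \<Rightarrow> 'a + nat"
  have p': "inj_on ?p (V <+> W)" by (rule inj_onI) (auto simp: inj_on_eq_iff[OF p])
  have pX: "?p ` (X <+> W) = X <+> p ` W" for X by (simp add: Plus_def image_Un image_image)
  let ?c = "c \<circ> inv_into E (map_prod ?p q)"
  have h: "inj_on (map_prod ?p q) E" using map_prod_inj_on[OF p' q] fin(3) by (rule inj_on_subset)
  have "represents V d f (p ` W) (q ` U) (map_prod ?p q ` E) ?c ((`) q ` \<B>)"
    unfolding represents_def
  proof (intro conjI ballI)
    have "map_prod ?p q ` E \<subseteq> map_prod ?p q ` ((V <+> W) \<times> U)" using fin(3) by (rule image_mono)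
    then show "map_prod ?p q ` E \<subseteq> (V <+> p ` W) \<times> q ` U"
      unfolding map_prod_surj_on[OF refl refl] pX .
    show "matroid_with_bases (q ` U) (d + card (p ` W)) ((`) q ` \<B>)"
      using matroid_with_bases_image[OF M q] card_image[OF p] by simp
    fix X assume X: "X \<in> nsets V d"
    have "matching_value E c \<B> (X <+> W) =
        matching_value (map_prod ?p q ` E) ?c ((`) q ` \<B>) (?p ` (X <+> W))"
    proof (rule matching_value_image[OF fin(3) p' q])
      show "X <+> W \<subseteq> V <+> W" using X by (auto simp: nsets_def)
      show "B \<subseteq> U" if "B \<in> \<B>" for B using matroid_with_bases_basis(1)[OF M that] .
      fix l u assume "(l, u) \<in> E"
      then show "?c (?p l, q u) = c (l, u)" using inv_into_f_f[OF h, of "(l, u)"] by simp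
    qed
    then show "f X = matching_value (map_prod ?p q ` E) ?c ((`) q ` \<B>) (X <+> p ` W)"
      using f[OF X] by (simp add: pX)
  qed (use fin in simp_all)
  then show ?thesis unfolding r_minor_iff_represents by blast
qed

section \<open>Restriction and dual\<close>

lemma r_minor_restriction:
  assumes "r_minor V d f"
  shows "r_minor (V - Y) d (vm_restriction V d f Y)"
proof -
  obtain W U :: "nat set" and E c \<B> where R: "represents V d f W U E c \<B>"
    using assms unfolding r_minor_iff_represents by blast
  let ?E = "E \<inter> (((V - Y) <+> W) \<times> UNIV)"
  have "represents (V - Y) d (vm_restriction V d f Y) W U ?E c \<B>"
    unfolding represents_def
  proof (intro conjI ballI)
    show "finite (V - Y)" "finite W" "matroid_with_bases U (d + card W) \<B>"
      using R by (simp_all add: represents_def)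
    have "E \<subseteq> (V <+> W) \<times> U" using R by (simp add: represents_def)
    then show "?E \<subseteq> ((V - Y) <+> W) \<times> U" by auto
    fix X assume X: "X \<in> nsets (V - Y) d"
    then have X': "X \<in> nsets V d" by (auto simp: nsets_def)
    have sub: "X <+> W \<subseteq> (V - Y) <+> W" using X by (auto simp: nsets_def)
    have "matching_onto ?E \<B> (X <+> W) N \<longleftrightarrow> matching_onto E \<B> (X <+> W) N" for N
    proof -
      have "N \<subseteq> ((V - Y) <+> W) \<times> UNIV" if "fst ` N = X <+> W"
      proof
        fix e assume "e \<in> N"
        then have "fst e \<in> X <+> W" using that by blast
        then show "e \<in> ((V - Y) <+> W) \<times> UNIV" using sub by (cases e) auto
      qed
      then show ?thesis by (auto simp: matching_onto_def)
    qed
    then have "{N. matching_onto ?E \<B> (X <+> W) N} = {N. matching_onto E \<B> (X <+> W) N}"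
      by (rule Collect_cong)
    then have "matching_value ?E c \<B> (X <+> W) = matching_value E c \<B> (X <+> W)"
      unfolding matching_value_def by (rule arg_cong)
    then show "vm_restriction V d f Y X = matching_value ?E c \<B> (X <+> W)"
      using R X X' by (simp add: vm_restriction_def represents_def)
  qed
  then show ?thesis by (rule represents_imp_r_minor)
qed

lemma inj_on_Un_disjoint:
  "inj_on f A \<Longrightarrow> inj_on f B \<Longrightarrow> f ` A \<inter> f ` B = {} \<Longrightarrow> inj_on f (A \<union> B)"
  by (auto simp: inj_on_Un)

text \<open>
  The left summand of the right side holds copies of \<open>V \<union> W\<close>, which will be coloops; the right
  summand holds copies of \<open>U\<close>, which will carry the dual matroid. Edges of \<open>E\<close> are reversed.
\<close>

definition dual_edges :: "'a set \<Rightarrow> 'u set \<Rightarrow> (('a + 'w) \<times> 'u) set \<Rightarrow>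
    (('a + 'u) \<times> (('a + 'w) + 'u)) set" where
  "dual_edges V U E = (\<lambda>v. (Inl v, Inl (Inl v))) ` V \<union> (\<lambda>u. (Inr u, Inr u)) ` U \<union>
     (\<lambda>(l, u). (Inr u, Inl l)) ` E"

fun dual_weight :: "(('a + 'w) \<times> 'u \<Rightarrow> real) \<Rightarrow> ('a + 'u) \<times> (('a + 'w) + 'u) \<Rightarrow> real" where
  "dual_weight c (Inr u, Inl l) = c (l, u)"
| "dual_weight c _ = 0"

lemma sum_dual_weight:
  fixes N :: "(('a + 'u) \<times> (('a + 'w) + 'u)) set"
  assumes "finite N"
  shows "sum (dual_weight c) N = sum c {(l, u). (Inr u, Inl l) \<in> N}"
proof -
  let ?h = "\<lambda>(l, u). (Inr u, Inl l) :: ('a + 'u) \<times> (('a + 'w) + 'u)"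
  let ?M = "{(l, u). (Inr u, Inl l) \<in> N}"
  have inj: "inj_on ?h ?M" by (auto simp: inj_on_def)
  have "sum (dual_weight c) N = sum (dual_weight c) (?h ` ?M)"
  proof (rule sum.mono_neutral_right)
    show "\<forall>e\<in>N - ?h ` ?M. dual_weight c e = 0"
    proof
      fix e assume "e \<in> N - ?h ` ?M"
      then show "dual_weight c e = 0" by (induction c e rule: dual_weight.induct) auto
    qed
  qed (use assms in auto)
  also have "\<dots> = sum c ?M"
    by (subst sum.reindex[OF inj]) (auto intro: sum.cong)
  finally show ?thesis .
qed

text \<open>
  A matching for \<open>V - X\<close> is turned around. Elements of \<open>X\<close> take their own copies, and right vertices
  outside the basis take their copies in the dual matroid.
\<close>

lemma dual_matching:
  fixes E :: "(('a + 'w) \<times> 'u) set"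
  assumes E: "E \<subseteq> (V <+> W) \<times> U" and X: "X \<subseteq> V" and fin: "finite V" "finite U" "finite E"
    and N: "matching_onto E \<B> ((V - X) <+> W) N"
  shows "\<exists>N'. matching_onto (dual_edges V U E) ((<+>) (V <+> W) ` (-) U ` \<B>) (X <+> U) N' \<and>
    sum (dual_weight c) N' = sum c N"
proof -
  have N: "N \<subseteq> E" "inj_on fst N" "inj_on snd N" "fst ` N = (V - X) <+> W" "snd ` N \<in> \<B>"
    using N by (simp_all add: matching_onto_def)
  have NU: "snd ` N \<subseteq> U" using N(1) E by auto
  let ?A = "(\<lambda>v. (Inl v, Inl (Inl v))) ` X :: (('a + 'u) \<times> (('a + 'w) + 'u)) set"
  let ?B = "(\<lambda>u. (Inr u, Inr u)) ` (U - snd ` N) :: (('a + 'u) \<times> (('a + 'w) + 'u)) set"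
  let ?C = "(\<lambda>(l, u). (Inr u, Inl l)) ` N :: (('a + 'u) \<times> (('a + 'w) + 'u)) set"
  have fsts: "fst ` ?A = Inl ` X" "fst ` ?B = Inr ` (U - snd ` N)" "fst ` ?C = Inr ` snd ` N"
    by (auto simp: image_image split_def)
  have snds: "snd ` ?A = Inl ` Inl ` X" "snd ` ?B = Inr ` (U - snd ` N)" "snd ` ?C = Inl ` fst ` N"
    by (auto simp: image_image split_def)
  have inj: "inj_on fst ?A" "inj_on fst ?B" "inj_on snd ?A" "inj_on snd ?B"
    by (auto simp: inj_on_def)
  have injC: "inj_on fst ?C" "inj_on snd ?C"
    by (rule inj_onI, use inj_onD[OF N(3)] inj_onD[OF N(2)] in fastforce)+
  have "inj_on fst (?A \<union> ?B \<union> ?C)"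
    using fsts by (intro inj_on_Un_disjoint inj injC) (auto simp: image_Un)
  moreover have "inj_on snd (?A \<union> ?B \<union> ?C)"
  proof (intro inj_on_Un_disjoint inj injC)
    show "snd ` ?A \<inter> snd ` ?B = {}" unfolding snds by blast
    show "snd ` (?A \<union> ?B) \<inter> snd ` ?C = {}" unfolding image_Un snds N(4) by auto
  qed
  moreover have "fst ` (?A \<union> ?B \<union> ?C) = X <+> U"
    unfolding image_Un fsts Plus_def using NU by blast
  moreover have "snd ` (?A \<union> ?B \<union> ?C) = (V <+> W) <+> (U - snd ` N)"
    unfolding image_Un snds N(4) Plus_def using X by blast
  moreover have "?A \<union> ?B \<union> ?C \<subseteq> dual_edges V U E"
    unfolding dual_edges_def using X N(1) by blast
  ultimately have "matching_onto (dual_edges V U E) ((<+>) (V <+> W) ` (-) U ` \<B>) (X <+> U)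
      (?A \<union> ?B \<union> ?C)"
    using N(5) by (simp add: matching_onto_def)
  moreover have "sum (dual_weight c) (?A \<union> ?B \<union> ?C) = sum c N"
  proof -
    have "finite (?A \<union> ?B \<union> ?C)"
      using fin finite_subset[OF X] finite_subset[OF N(1)] by simp
    moreover have "{(l, u). (Inr u, Inl l) \<in> ?A \<union> ?B \<union> ?C} = N" by auto
    ultimately show ?thesis by (simp only: sum_dual_weight)
  qed
  ultimately show ?thesis by blast
qed

text \<open>
  The reversed edges of a matching for \<open>X\<close> are a matching for \<open>V - X\<close>. Indeed the copies of \<open>V \<union> W\<close> are
  all covered, exactly those of \<open>X\<close> by their own element; and the vertices of \<open>U\<close> are all matched,
  exactly those in the complement of the basis with their own copy.
\<close>

lemma dual_matching_converse:
  assumes E: "E \<subseteq> (V <+> W) \<times> U" and X: "X \<subseteq> V" and fin: "finite V" "finite U" "finite E"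
    and \<B>: "\<And>B. B \<in> \<B> \<Longrightarrow> B \<subseteq> U"
    and N': "matching_onto (dual_edges V U E) ((<+>) (V <+> W) ` (-) U ` \<B>) (X <+> U) N'"
  shows "\<exists>N. matching_onto E \<B> ((V - X) <+> W) N \<and> sum c N = sum (dual_weight c) N'"
proof -
  define N where "N = {(l, u). (Inr u, Inl l) \<in> N'}"
  have N': "N' \<subseteq> dual_edges V U E" "inj_on fst N'" "inj_on snd N'" "fst ` N' = X <+> U"
    "snd ` N' \<in> (<+>) (V <+> W) ` (-) U ` \<B>"
    using N' by (simp_all add: matching_onto_def)
  obtain B where B: "B \<in> \<B>" "snd ` N' = (V <+> W) <+> (U - B)" using N'(5) by blast
  have BU: "B \<subseteq> U" using \<B>[OF B(1)] .
  have NE: "N \<subseteq> E" using N'(1) by (auto simp: N_def dual_edges_def)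
  have out_v: "y = Inl (Inl v)" if "(Inl v, y) \<in> N'" for v y
    using that N'(1) by (auto simp: dual_edges_def)
  have out_u: "y = Inr u \<or> (\<exists>l. y = Inl l \<and> (l, u) \<in> N)" if "(Inr u, y) \<in> N'" for u y
    using that N'(1) by (auto simp: dual_edges_def N_def)
  have in_u: "x = Inr u" if "(x, Inr u) \<in> N'" for x u
    using that N'(1) by (auto simp: dual_edges_def)
  have in_l: "(\<exists>v. l = Inl v \<and> x = Inl v) \<or> (\<exists>u. x = Inr u \<and> (l, u) \<in> N)" if "(x, Inl l) \<in> N'" for x l
    using that N'(1) by (auto simp: dual_edges_def N_def)
  have v_iff: "(Inl v, Inl (Inl v)) \<in> N' \<longleftrightarrow> v \<in> X" for v
  proof -
    have "v \<in> X \<longleftrightarrow> Inl v \<in> fst ` N'" unfolding N'(4) by auto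
    also have "\<dots> \<longleftrightarrow> (Inl v, Inl (Inl v)) \<in> N'" using out_v by force
    finally show ?thesis by blast
  qed
  have u_iff: "(Inr u, Inr u) \<in> N' \<longleftrightarrow> u \<in> U - B" for u
  proof -
    have "u \<in> U - B \<longleftrightarrow> Inr u \<in> snd ` N'" unfolding B(2) by auto
    also have "\<dots> \<longleftrightarrow> (Inr u, Inr u) \<in> N'" using in_u by force
    finally show ?thesis by blast
  qed
  have "inj_on fst N"
    by (rule inj_onI) (use inj_onD[OF N'(3)] in \<open>fastforce simp: N_def\<close>)
  moreover have "inj_on snd N"
    by (rule inj_onI) (use inj_onD[OF N'(2)] in \<open>fastforce simp: N_def\<close>)
  moreover have "fst ` N = (V - X) <+> W"
  proof (intro equalityI subsetI)
    fix l assume "l \<in> fst ` N"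
    then obtain u where u: "(Inr u, Inl l) \<in> N'" "(l, u) \<in> N" by (auto simp: N_def)
    have "l \<in> V <+> W" using u(2) NE E by blast
    moreover have "v \<notin> X" if "l = Inl v" for v
    proof
      assume "v \<in> X"
      then have "(Inl v, Inl l) \<in> N'" using v_iff that by blast
      then show False using inj_onD[OF N'(3) _ u(1)] by force
    qed
    ultimately show "l \<in> (V - X) <+> W" by auto
  next
    fix l assume l: "l \<in> (V - X) <+> W"
    then have "Inl l \<in> snd ` N'" unfolding B(2) by auto
    then obtain x where x: "(x, Inl l) \<in> N'" by force
    have "\<not> (\<exists>v. l = Inl v \<and> x = Inl v)" using l x v_iff by auto
    then show "l \<in> fst ` N" using in_l[OF x] by force
  qed
  moreover have "snd ` N = B"
  proof (intro equalityI subsetI)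
    fix u assume "u \<in> snd ` N"
    then obtain l where l: "(Inr u, Inl l) \<in> N'" "(l, u) \<in> N" by (auto simp: N_def)
    have "u \<in> U" using l(2) NE E by blast
    moreover have "u \<notin> U - B"
    proof
      assume "u \<in> U - B"
      then have "(Inr u, Inr u) \<in> N'" using u_iff by blast
      then show False using inj_onD[OF N'(2) _ l(1)] by force
    qed
    ultimately show "u \<in> B" by blast
  next
    fix u assume u: "u \<in> B"
    then have "Inr u \<in> fst ` N'" unfolding N'(4) using BU by auto
    then obtain y where y: "(Inr u, y) \<in> N'" by force
    have "y \<noteq> Inr u" using u y u_iff by auto
    then show "u \<in> snd ` N" using out_u[OF y] by force
  qed
  ultimately have "matching_onto E \<B> ((V - X) <+> W) N" using NE B(1) by (simp add: matching_onto_def)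
  moreover have "finite N'"
  proof (rule finite_subset[OF N'(1)])
    show "finite (dual_edges V U E)" using fin by (simp add: dual_edges_def)
  qed
  ultimately show ?thesis using sum_dual_weight[of N' c] unfolding N_def by metis
qed

text \<open>
  On the right stands the direct sum of the free matroid on the copies of \<open>V \<union> W\<close> and of the dual of
  the old matroid. With \<open>r = d + card W\<close>, its rank \<open>card V + card W + (card U - r)\<close> equals
  \<open>card V - d + card U\<close>, as it has to when \<open>U\<close> is the contracted set.
\<close>

lemma r_minor_dual:
  assumes "r_minor V d f" and d: "d \<le> card V"
  shows "r_minor V (card V - d) (vm_dual V f)"
proof -
  obtain W U :: "nat set" and E c \<B> where R: "represents V d f W U E c \<B>"
    using assms unfolding r_minor_iff_represents by blast
  have fin: "finite V" "finite W" and E: "E \<subseteq> (V <+> W) \<times> U"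
    and M: "matroid_with_bases U (d + card W) \<B>"
    and f: "\<And>X. X \<in> nsets V d \<Longrightarrow> f X = matching_value E c \<B> (X <+> W)"
    using R by (simp_all add: represents_def)
  have finU: "finite U" using matroid_with_bases_finite[OF M] .
  have finE: "finite E" using represents_finite_edges[OF R] .
  let ?\<B> = "(<+>) (V <+> W) ` (-) U ` \<B>"
  have "represents V (card V - d) (vm_dual V f) U ((V <+> W) <+> U) (dual_edges V U E) (dual_weight c) ?\<B>"
    unfolding represents_def
  proof (intro conjI ballI)
    show "dual_edges V U E \<subseteq> (V <+> U) \<times> ((V <+> W) <+> U)"
      using E by (auto simp: dual_edges_def)
    have "matroid_with_bases ((V <+> W) <+> U) (card (V <+> W) + (card U - (d + card W)))
        {B1 <+> B2 |B1 B2. B1 \<in> {V <+> W} \<and> B2 \<in> (-) U ` \<B>}"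
      using fin by (intro matroid_with_bases_direct_sum matroid_with_bases_free
          matroid_with_bases_dual[OF M]) simp
    moreover have "{B1 <+> B2 |B1 B2. B1 \<in> {V <+> W} \<and> B2 \<in> (-) U ` \<B>} = ?\<B>" by auto
    moreover have "card (V <+> W) + (card U - (d + card W)) = card V - d + card U"
      using d matroid_with_bases_rank_le[OF M] fin by (simp add: card_Plus)
    ultimately show "matroid_with_bases ((V <+> W) <+> U) (card V - d + card U) ?\<B>" by simp
    fix X assume "X \<in> nsets V (card V - d)"
    then have X: "X \<subseteq> V" "card X = card V - d" by (simp_all add: nsets_def)
    have "V - X \<in> nsets V d"
      using X d fin by (auto simp: nsets_def card_Diff_subset finite_subset)
    then have "vm_dual V f X = matching_value E c \<B> ((V - X) <+> W)" by (simp add: vm_dual_def f)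
    also have "\<dots> = matching_value (dual_edges V U E) (dual_weight c) ?\<B> (X <+> U)"
      using dual_matching[OF E X(1) fin(1) finU finE]
        dual_matching_converse[OF E X(1) fin(1) finU finE matroid_with_bases_basis(1)[OF M]]
      by (intro matching_value_eqI) blast+
    finally show "vm_dual V f X = matching_value (dual_edges V U E) (dual_weight c) ?\<B> (X <+> U)" .
  qed (use fin finU in simp_all)
  then show ?thesis by (rule represents_imp_r_minor)
qed

section \<open>Direct sum\<close>

lemma represents_upper:
  assumes "represents V d f W U E c \<B>" "X \<in> nsets V d" "matching_onto E \<B> (X <+> W) N"
  shows "ereal (sum c N) \<le> f X"
  using assms matching_value_upper by (simp add: represents_def)

lemma represents_attained:
  assumes R: "represents V d f W U E c \<B>" and X: "X \<in> nsets V d" "f X \<noteq> -\<infinity>"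
  obtains N where "matching_onto E \<B> (X <+> W) N" "f X = ereal (sum c N)"
proof -
  have f: "f X = matching_value E c \<B> (X <+> W)" using R X by (simp add: represents_def)
  show ?thesis
    using matching_value_attained[OF represents_finite_edges[OF R], of c \<B> "X <+> W"] X(2) that
    unfolding f by blast
qed

fun sum_weight :: "(('a + 'w) \<times> 'u \<Rightarrow> real) \<Rightarrow> (('a + 'x) \<times> 'v \<Rightarrow> real) \<Rightarrow>
    ('a + ('w + 'x)) \<times> ('u + 'v) \<Rightarrow> real" where
  "sum_weight c1 c2 (Inl v, Inl u) = c1 (Inl v, u)"
| "sum_weight c1 c2 (Inr (Inl w), Inl u) = c1 (Inr w, u)"
| "sum_weight c1 c2 (Inl v, Inr u) = c2 (Inl v, u)"
| "sum_weight c1 c2 (Inr (Inr w), Inr u) = c2 (Inr w, u)"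
| "sum_weight c1 c2 _ = 0"

abbreviation into1 :: "('a + 'w) \<times> 'u \<Rightarrow> ('a + ('w + 'x)) \<times> ('u + 'v)" where
  "into1 \<equiv> map_prod (map_sum id Inl) Inl"

abbreviation into2 :: "('a + 'x) \<times> 'v \<Rightarrow> ('a + ('w + 'x)) \<times> ('u + 'v)" where
  "into2 \<equiv> map_prod (map_sum id Inr) Inr"

lemma inj_into: "inj (map_sum id Inl)" "inj (map_sum id Inr)"
  by (simp_all add: sum.inj_map)

lemma sum_sum_weight:
  assumes "finite N1" "finite N2"
  shows "sum (sum_weight c1 c2) (into1 ` N1 \<union> into2 ` N2) = sum c1 N1 + sum c2 N2"
proof -
  have inj: "inj_on into1 N1" "inj_on into2 N2"
    by (auto intro!: inj_on_subset[OF prod.inj_map] inj_into)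
  have "sum (sum_weight c1 c2) (into1 ` N1 \<union> into2 ` N2) =
      sum (sum_weight c1 c2) (into1 ` N1) + sum (sum_weight c1 c2) (into2 ` N2)"
    using assms by (intro sum.union_disjoint) auto
  also have "sum (sum_weight c1 c2) (into1 ` N1) = sum c1 N1"
    unfolding sum.reindex[OF inj(1)]
  proof (rule sum.cong)
    show "(sum_weight c1 c2 \<circ> into1) e = c1 e" for e by (cases e; cases "fst e") auto
  qed simp
  also have "sum (sum_weight c1 c2) (into2 ` N2) = sum c2 N2"
    unfolding sum.reindex[OF inj(2)]
  proof (rule sum.cong)
    show "(sum_weight c1 c2 \<circ> into2) e = c2 e" for e by (cases e; cases "fst e") auto
  qed simp
  finally show ?thesis .
qed

lemma inj_on_into:
  "inj_on fst (into1 ` N) \<longleftrightarrow> inj_on fst N" "inj_on snd (into1 ` N) \<longleftrightarrow> inj_on snd N"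
  "inj_on fst (into2 ` N) \<longleftrightarrow> inj_on fst N" "inj_on snd (into2 ` N) \<longleftrightarrow> inj_on snd N"
  by (rule inj_on_map_prod_image[of _ UNIV UNIV]; simp add: inj_into)+

lemma image_into:
  "fst ` into1 ` N = map_sum id Inl ` fst ` N" "snd ` into1 ` N = Inl ` snd ` N"
  "fst ` into2 ` N = map_sum id Inr ` fst ` N" "snd ` into2 ` N = Inr ` snd ` N"
  by (simp_all add: image_image)

lemma image_map_sum_Plus: "map_sum f g ` (A <+> B) = f ` A <+> g ` B"
  by (simp add: Plus_def image_Un image_image)

lemma Inl_mem_map_sum: "Inl v \<in> map_sum id g ` S \<longleftrightarrow> Inl v \<in> S"
proof
  assume "Inl v \<in> map_sum id g ` S"
  then obtain s where "s \<in> S" "Inl v = map_sum id g s" by blast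
  then show "Inl v \<in> S" by (cases s) auto
qed force

lemma Inr_mem_map_sum: "Inr w \<in> map_sum id g ` S \<longleftrightarrow> (\<exists>w'. w = g w' \<and> Inr w' \<in> S)"
proof
  assume "Inr w \<in> map_sum id g ` S"
  then obtain s where "s \<in> S" "Inr w = map_sum id g s" by blast
  then show "\<exists>w'. w = g w' \<and> Inr w' \<in> S" by (cases s) auto
qed force

lemma image_Collect_Int: "h ` {e \<in> S. h e \<in> N} = h ` S \<inter> N"
  by auto

lemma Plus_eqI:
  assumes "\<And>x. Inl x \<in> S \<longleftrightarrow> x \<in> A" "\<And>y. Inr y \<in> S \<longleftrightarrow> y \<in> B"
  shows "S = A <+> B"
proof (rule set_eqI)
  show "z \<in> S \<longleftrightarrow> z \<in> A <+> B" for z using assms by (cases z) auto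
qed

lemma Plus_eq_Plus_iff: "A <+> B = C <+> D \<longleftrightarrow> A = C \<and> B = D"
proof
  assume eq: "A <+> B = C <+> D"
  have "x \<in> A \<longleftrightarrow> x \<in> C" for x using arg_cong[OF eq, of "\<lambda>S. Inl x \<in> S"] by auto
  moreover have "x \<in> B \<longleftrightarrow> x \<in> D" for x using arg_cong[OF eq, of "\<lambda>S. Inr x \<in> S"] by auto
  ultimately show "A = C \<and> B = D" by blast
qed simp

lemma direct_sum_matching:
  assumes V: "V1 \<inter> V2 = {}" and X: "X \<subseteq> V1 \<union> V2"
    and N1: "matching_onto E1 \<B>1 ((X \<inter> V1) <+> W1) N1"
    and N2: "matching_onto E2 \<B>2 ((X \<inter> V2) <+> W2) N2"
  shows "matching_onto (into1 ` E1 \<union> into2 ` E2) {B1 <+> B2 |B1 B2. B1 \<in> \<B>1 \<and> B2 \<in> \<B>2}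
    (X <+> (W1 <+> W2)) (into1 ` N1 \<union> into2 ` N2)"
proof -
  have N1: "N1 \<subseteq> E1" "inj_on fst N1" "inj_on snd N1" "fst ` N1 = (X \<inter> V1) <+> W1" "snd ` N1 \<in> \<B>1"
    using N1 by (simp_all add: matching_onto_def)
  have N2: "N2 \<subseteq> E2" "inj_on fst N2" "inj_on snd N2" "fst ` N2 = (X \<inter> V2) <+> W2" "snd ` N2 \<in> \<B>2"
    using N2 by (simp_all add: matching_onto_def)
  have f: "fst ` into1 ` N1 = (X \<inter> V1) <+> Inl ` W1" "fst ` into2 ` N2 = (X \<inter> V2) <+> Inr ` W2"
    unfolding image_into N1(4) N2(4) image_map_sum_Plus by simp_all
  have "inj_on fst (into1 ` N1 \<union> into2 ` N2)"
  proof (rule inj_on_Un_disjoint)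
    show "fst ` into1 ` N1 \<inter> fst ` into2 ` N2 = {}" unfolding f using V by auto
  qed (simp_all only: inj_on_into N1 N2)
  moreover have "inj_on snd (into1 ` N1 \<union> into2 ` N2)"
  proof (rule inj_on_Un_disjoint)
    show "snd ` into1 ` N1 \<inter> snd ` into2 ` N2 = {}" unfolding image_into by auto
  qed (simp_all only: inj_on_into N1 N2)
  moreover have "fst ` (into1 ` N1 \<union> into2 ` N2) = X <+> (W1 <+> W2)"
    unfolding image_Un f using X by (auto simp: Plus_def)
  moreover have "snd ` (into1 ` N1 \<union> into2 ` N2) = snd ` N1 <+> snd ` N2"
    unfolding image_Un image_into Plus_def ..
  ultimately show ?thesis
    using N1(1,5) N2(1,5) image_mono[OF N1(1), of into1] image_mono[OF N2(1), of into2]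
    unfolding matching_onto_def by blast
qed

lemma direct_sum_matching_converse:
  assumes V: "V1 \<inter> V2 = {}" and E1: "E1 \<subseteq> (V1 <+> W1) \<times> U1" and E2: "E2 \<subseteq> (V2 <+> W2) \<times> U2"
    and N: "matching_onto (into1 ` E1 \<union> into2 ` E2) {B1 <+> B2 |B1 B2. B1 \<in> \<B>1 \<and> B2 \<in> \<B>2}
      (X <+> (W1 <+> W2)) N"
  obtains N1 N2 where "N = into1 ` N1 \<union> into2 ` N2"
    "matching_onto E1 \<B>1 ((X \<inter> V1) <+> W1) N1" "matching_onto E2 \<B>2 ((X \<inter> V2) <+> W2) N2"
proof -
  have N: "N \<subseteq> into1 ` E1 \<union> into2 ` E2" "inj_on fst N" "inj_on snd N"
      "fst ` N = X <+> (W1 <+> W2)"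
    and "snd ` N \<in> {B1 <+> B2 |B1 B2. B1 \<in> \<B>1 \<and> B2 \<in> \<B>2}"
    using N by (simp_all add: matching_onto_def)
  then obtain B1 B2 where B: "snd ` N = B1 <+> B2" "B1 \<in> \<B>1" "B2 \<in> \<B>2" by blast
  define N1 where "N1 = {e \<in> E1. into1 e \<in> N}"
  define N2 where "N2 = {e \<in> E2. into2 e \<in> N}"
  have sub: "N1 \<subseteq> E1" "N2 \<subseteq> E2" by (auto simp: N1_def N2_def)
  have un: "N = into1 ` N1 \<union> into2 ` N2" using N(1) unfolding N1_def N2_def image_Collect_Int by blast
  have left: "fst ` N1 \<subseteq> V1 <+> W1" "fst ` N2 \<subseteq> V2 <+> W2" using sub E1 E2 by auto
  have inj: "inj_on fst N1" "inj_on snd N1" "inj_on fst N2" "inj_on snd N2"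
    using N(2,3) unfolding un inj_on_Un inj_on_into by simp_all
  have "snd ` N1 <+> snd ` N2 = B1 <+> B2"
    using B(1) unfolding un image_Un image_into Plus_def .
  then have snds: "snd ` N1 = B1" "snd ` N2 = B2" by (simp_all only: Plus_eq_Plus_iff)
  have fsts: "map_sum id Inl ` fst ` N1 \<union> map_sum id Inr ` fst ` N2 = X <+> (W1 <+> W2)"
    using N(4) unfolding un image_Un image_into .
  have v: "v \<in> X \<longleftrightarrow> Inl v \<in> fst ` N1 \<or> Inl v \<in> fst ` N2" for v
  proof -
    have "v \<in> X \<longleftrightarrow> Inl v \<in> map_sum id Inl ` fst ` N1 \<union> map_sum id Inr ` fst ` N2"
      unfolding fsts by auto
    also have "\<dots> \<longleftrightarrow> Inl v \<in> fst ` N1 \<or> Inl v \<in> fst ` N2"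
      unfolding Un_iff Inl_mem_map_sum ..
    finally show ?thesis .
  qed
  have w1: "w \<in> W1 \<longleftrightarrow> Inr w \<in> fst ` N1" for w
  proof -
    have "w \<in> W1 \<longleftrightarrow> Inr (Inl w) \<in> map_sum id Inl ` fst ` N1 \<union> map_sum id Inr ` fst ` N2"
      unfolding fsts by auto
    also have "\<dots> \<longleftrightarrow> Inr w \<in> fst ` N1" unfolding Un_iff Inr_mem_map_sum by simp
    finally show ?thesis .
  qed
  have w2: "w \<in> W2 \<longleftrightarrow> Inr w \<in> fst ` N2" for w
  proof -
    have "w \<in> W2 \<longleftrightarrow> Inr (Inr w) \<in> map_sum id Inl ` fst ` N1 \<union> map_sum id Inr ` fst ` N2"
      unfolding fsts by auto
    also have "\<dots> \<longleftrightarrow> Inr w \<in> fst ` N2" unfolding Un_iff Inr_mem_map_sum by simp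
    finally show ?thesis .
  qed
  have "fst ` N1 = (X \<inter> V1) <+> W1"
  proof (rule Plus_eqI)
    show "Inl v \<in> fst ` N1 \<longleftrightarrow> v \<in> X \<inter> V1" for v
    proof -
      have "v \<in> V1" if "Inl v \<in> fst ` N1" using subsetD[OF left(1) that] by blast
      moreover have "v \<in> V2" if "Inl v \<in> fst ` N2" using subsetD[OF left(2) that] by blast
      ultimately show ?thesis using v[of v] V by blast
    qed
  qed (simp only: w1)
  moreover have "fst ` N2 = (X \<inter> V2) <+> W2"
  proof (rule Plus_eqI)
    show "Inl v \<in> fst ` N2 \<longleftrightarrow> v \<in> X \<inter> V2" for v
    proof -
      have "v \<in> V1" if "Inl v \<in> fst ` N1" using subsetD[OF left(1) that] by blast
      moreover have "v \<in> V2" if "Inl v \<in> fst ` N2" using subsetD[OF left(2) that] by blast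
      ultimately show ?thesis using v[of v] V by blast
    qed
  qed (simp only: w2)
  ultimately show ?thesis using that[OF un] inj snds B sub by (simp add: matching_onto_def)
qed

text \<open>
  For direct sums, this yields the value \<open>-\<infinity>\<close> on sets that do not meet the two ground sets in
  the prescribed numbers of elements: no matching exists.
\<close>

lemma matching_onto_card:
  assumes "matching_onto E \<B> Z N" and M: "matroid_with_bases U r \<B>"
  shows "card Z = r"
proof -
  have N: "inj_on fst N" "inj_on snd N" "fst ` N = Z" "snd ` N \<in> \<B>"
    using assms(1) by (simp_all add: matching_onto_def)
  have "card Z = card N" using card_image[OF N(1)] N(3) by simp
  also have "\<dots> = card (snd ` N)" using card_image[OF N(2)] by simp
  also have "\<dots> = r" using matroid_with_bases_basis(3)[OF M N(4)] .
  finally show ?thesis .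
qed

lemma r_minor_direct_sum:
  assumes "r_minor V1 d1 f1" "r_minor V2 d2 f2" and V: "V1 \<inter> V2 = {}"
  shows "r_minor (V1 \<union> V2) (d1 + d2) (vm_direct_sum V1 d1 f1 V2 d2 f2)"
proof -
  obtain W1 U1 :: "nat set" and E1 c1 \<B>1 where R1: "represents V1 d1 f1 W1 U1 E1 c1 \<B>1"
    using assms(1) unfolding r_minor_iff_represents by blast
  obtain W2 U2 :: "nat set" and E2 c2 \<B>2 where R2: "represents V2 d2 f2 W2 U2 E2 c2 \<B>2"
    using assms(2) unfolding r_minor_iff_represents by blast
  have fin1: "finite V1" "finite W1" and E1: "E1 \<subseteq> (V1 <+> W1) \<times> U1"
    and M1: "matroid_with_bases U1 (d1 + card W1) \<B>1" using R1 by (simp_all add: represents_def)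
  have fin2: "finite V2" "finite W2" and E2: "E2 \<subseteq> (V2 <+> W2) \<times> U2"
    and M2: "matroid_with_bases U2 (d2 + card W2) \<B>2" using R2 by (simp_all add: represents_def)
  let ?f = "vm_direct_sum V1 d1 f1 V2 d2 f2"
  let ?E = "into1 ` E1 \<union> into2 ` E2 :: (('a + (nat + nat)) \<times> (nat + nat)) set"
  let ?c = "sum_weight c1 c2"
  let ?\<B> = "{B1 <+> B2 |B1 B2. B1 \<in> \<B>1 \<and> B2 \<in> \<B>2}"
  have "represents (V1 \<union> V2) (d1 + d2) ?f (W1 <+> W2) (U1 <+> U2) ?E ?c ?\<B>"
    unfolding represents_def
  proof (intro conjI ballI)
    show "?E \<subseteq> ((V1 \<union> V2) <+> (W1 <+> W2)) \<times> (U1 <+> U2)"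
      using E1 E2 by fastforce
    have "(d1 + card W1) + (d2 + card W2) = d1 + d2 + card (W1 <+> W2)"
      using fin1 fin2 by (simp add: card_Plus)
    then show "matroid_with_bases (U1 <+> U2) (d1 + d2 + card (W1 <+> W2)) ?\<B>"
      using matroid_with_bases_direct_sum[OF M1 M2] by (simp only:)
    fix X assume "X \<in> nsets (V1 \<union> V2) (d1 + d2)"
    then have X: "X \<subseteq> V1 \<union> V2" by (simp add: nsets_def)
    let ?X1 = "X \<inter> V1" and ?X2 = "X \<inter> V2"
    let ?v = "matching_value ?E ?c ?\<B> (X <+> (W1 <+> W2))"
    have ns: "?X1 \<in> nsets V1 d1" "?X2 \<in> nsets V2 d2" if "card ?X1 = d1 \<and> card ?X2 = d2"
      using that fin1 fin2 by (simp_all add: nsets_def)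
    show "?f X = ?v"
    proof (rule antisym)
      show "?f X \<le> ?v"
      proof (cases "(card ?X1 = d1 \<and> card ?X2 = d2) \<and> f1 ?X1 \<noteq> -\<infinity> \<and> f2 ?X2 \<noteq> -\<infinity>")
        case True
        then have card: "card ?X1 = d1 \<and> card ?X2 = d2" by blast
        obtain N1 where N1: "matching_onto E1 \<B>1 (?X1 <+> W1) N1" "f1 ?X1 = ereal (sum c1 N1)"
          using represents_attained[OF R1 ns(1)[OF card]] True by blast
        obtain N2 where N2: "matching_onto E2 \<B>2 (?X2 <+> W2) N2" "f2 ?X2 = ereal (sum c2 N2)"
          using represents_attained[OF R2 ns(2)[OF card]] True by blast
        have "N1 \<subseteq> E1" "N2 \<subseteq> E2" using N1(1) N2(1) by (simp_all add: matching_onto_def)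
        then have "finite N1" "finite N2"
          using represents_finite_edges[OF R1] represents_finite_edges[OF R2] finite_subset by blast+
        then have "?f X = ereal (sum ?c (into1 ` N1 \<union> into2 ` N2))"
          using card N1(2) N2(2) by (simp add: vm_direct_sum_def sum_sum_weight)
        also have "\<dots> \<le> ?v"
          using direct_sum_matching[OF V X N1(1) N2(1)] by (rule matching_value_upper)
        finally show ?thesis .
      next
        case False
        have "f1 ?X1 \<noteq> \<infinity>" "f2 ?X2 \<noteq> \<infinity>" if "card ?X1 = d1 \<and> card ?X2 = d2"
          using ns[OF that] r_minor_valuated_matroid[OF assms(1)] r_minor_valuated_matroid[OF assms(2)]
          unfolding valuated_matroid_def by blast+
        then have "?f X = -\<infinity>" using False by (auto simp: vm_direct_sum_def)
        then show ?thesis by simp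
      qed
      show "?v \<le> ?f X"
        unfolding matching_value_def
      proof (rule SUP_least)
        fix N assume "N \<in> {N. matching_onto ?E ?\<B> (X <+> (W1 <+> W2)) N}"
        then have NX: "matching_onto ?E ?\<B> (X <+> (W1 <+> W2)) N" by (rule CollectD)
        obtain N1 N2 where N: "N = into1 ` N1 \<union> into2 ` N2"
          and N1: "matching_onto E1 \<B>1 (?X1 <+> W1) N1" and N2: "matching_onto E2 \<B>2 (?X2 <+> W2) N2"
          by (rule direct_sum_matching_converse[OF V E1 E2 NX])
        have "N1 \<subseteq> E1" "N2 \<subseteq> E2" using N1 N2 by (simp_all add: matching_onto_def)
        then have finN: "finite N1" "finite N2"
          using represents_finite_edges[OF R1] represents_finite_edges[OF R2] finite_subset by blast+
        have card: "card ?X1 = d1 \<and> card ?X2 = d2"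
          using matching_onto_card[OF N1 M1] matching_onto_card[OF N2 M2] fin1 fin2
          by (simp add: card_Plus)
        have "ereal (sum ?c N) = ereal (sum c1 N1) + ereal (sum c2 N2)"
          using finN by (simp add: N sum_sum_weight)
        also have "\<dots> \<le> f1 ?X1 + f2 ?X2"
          using represents_upper[OF R1 ns(1)[OF card] N1] represents_upper[OF R2 ns(2)[OF card] N2]
          by (rule add_mono)
        also have "\<dots> = ?f X" using card by (simp add: vm_direct_sum_def)
        finally show "ereal (sum ?c N) \<le> ?f X" .
      qed
    qed
  qed (use fin1 fin2 in simp_all)
  then show ?thesis by (rule represents_imp_r_minor)
qed

section \<open>Induction through a bipartite graph and principal extension\<close>

fun comp_weight :: "('a \<times> 'b \<Rightarrow> real) \<Rightarrow> (('b + 'w) \<times> 'u \<Rightarrow> real) \<Rightarrow>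
    ('a + ('b + 'w)) \<times> ('b + 'u) \<Rightarrow> real" where
  "comp_weight b c (Inl x, Inl v) = b (x, v)"
| "comp_weight b c (Inr l, Inr u) = c (l, u)"
| "comp_weight b c _ = 0"

text \<open>
  Two graphs in series, \<open>D\<close> from the new elements to \<open>V\<close> and \<open>E\<close> from \<open>V\<close> onwards. Each \<open>v\<close> of the middle
  layer occurs on the left, as a source of edges of \<open>E\<close>, and on the right, as a target of edges of
  \<open>D\<close>. The edge between its two copies serves the elements that no path passes through.
\<close>

definition comp_edges :: "('a \<times> 'b) set \<Rightarrow> 'b set \<Rightarrow> (('b + 'w) \<times> 'u) set \<Rightarrow>
    (('a + ('b + 'w)) \<times> ('b + 'u)) set" where
  "comp_edges D V E = map_prod Inl Inl ` D \<union> (\<lambda>v. (Inr (Inl v), Inl v)) ` V \<union> map_prod Inr Inr ` E"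

lemma sum_comp_weight:
  fixes N :: "(('a + ('b + 'w)) \<times> ('b + 'u)) set"
  assumes "finite N"
  shows "sum (comp_weight b c) N =
    sum b {(x, v). (Inl x, Inl v) \<in> N} + sum c {(l, u). (Inr l, Inr u) \<in> N}"
proof -
  let ?i = "map_prod Inl Inl :: 'a \<times> 'b \<Rightarrow> ('a + ('b + 'w)) \<times> ('b + 'u)"
    and ?j = "map_prod Inr Inr :: ('b + 'w) \<times> 'u \<Rightarrow> ('a + ('b + 'w)) \<times> ('b + 'u)"
  let ?K = "{(x, v). (Inl x, Inl v) \<in> N}" and ?M = "{(l, u). (Inr l, Inr u) \<in> N}"
  have inj: "inj_on (?i) ?K" "inj_on (?j) ?M"
    by (auto simp: inj_on_def)
  have sub: "?i ` ?K \<subseteq> N" "?j ` ?M \<subseteq> N" by auto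
  have fin: "finite (?i ` ?K)" "finite (?j ` ?M)"
    using finite_subset[OF _ assms] sub by simp_all
  have "sum (comp_weight b c) N = sum (comp_weight b c) (?i ` ?K \<union> ?j ` ?M)"
  proof (rule sum.mono_neutral_right)
    show "\<forall>e\<in>N - (?i ` ?K \<union> ?j ` ?M). comp_weight b c e = 0"
    proof
      fix e assume e: "e \<in> N - (?i ` ?K \<union> ?j ` ?M)"
      have "e \<noteq> (Inl x, Inl v)" for x v
        using e map_prod_imageI[of x v ?K Inl Inl] by auto
      moreover have "e \<noteq> (Inr l, Inr u)" for l u
        using e map_prod_imageI[of l u ?M Inr Inr] by auto
      ultimately show "comp_weight b c e = 0"
        by (cases "(b, c, e)" rule: comp_weight.cases) auto
    qed
  qed (use assms sub in simp_all)
  also have "\<dots> = sum (comp_weight b c) (?i ` ?K) + sum (comp_weight b c) (?j ` ?M)"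
    using fin by (intro sum.union_disjoint) auto
  also have "sum (comp_weight b c) (?i ` ?K) = sum b ?K"
    unfolding sum.reindex[OF inj(1)] by (rule sum.cong) auto
  also have "sum (comp_weight b c) (?j ` ?M) = sum c ?M"
    unfolding sum.reindex[OF inj(2)] by (rule sum.cong) auto
  finally show ?thesis .
qed

lemma comp_matching:
  fixes D :: "('a \<times> 'b) set" and E :: "(('b + 'w) \<times> 'u) set"
  assumes D: "D \<subseteq> A \<times> V" and fin: "finite D" "finite V" "finite E"
    and K: "matching D K" "fst ` K = X" and N: "matching_onto E \<B> (snd ` K <+> W) N"
  shows "\<exists>N'. matching_onto (comp_edges D V E) ((<+>) V ` \<B>) (X <+> (V <+> W)) N' \<and>
    sum (comp_weight b c) N' = sum b K + sum c N"
proof -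
  obtain M B where M: "snd ` K = M" and B: "snd ` N = B" by blast
  have K: "K \<subseteq> D" "inj_on fst K" "inj_on snd K" "fst ` K = X"
    using K by (simp_all add: matching_iff_inj_on)
  have N: "N \<subseteq> E" "inj_on fst N" "inj_on snd N" "fst ` N = M <+> W" "B \<in> \<B>"
    using N by (simp_all add: matching_onto_def M B)
  have MV: "M \<subseteq> V" using K(1) D unfolding M[symmetric] by auto
  let ?A = "map_prod Inl Inl ` K :: (('a + ('b + 'w)) \<times> ('b + 'u)) set"
  let ?B = "(\<lambda>v. (Inr (Inl v), Inl v)) ` (V - M) :: (('a + ('b + 'w)) \<times> ('b + 'u)) set"
  let ?C = "map_prod Inr Inr ` N :: (('a + ('b + 'w)) \<times> ('b + 'u)) set"
  have fsts: "fst ` ?A = Inl ` X" "fst ` ?B = Inr ` Inl ` (V - M)" "fst ` ?C = Inr ` (M <+> W)"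
    unfolding K(4)[symmetric] N(4)[symmetric] by (simp_all add: image_image)
  have snds: "snd ` ?A = Inl ` M" "snd ` ?B = Inl ` (V - M)" "snd ` ?C = Inr ` B"
    unfolding M[symmetric] B[symmetric] by (simp_all add: image_image)
  have inj: "inj_on fst ?B" "inj_on snd ?B" by (auto simp: inj_on_def)
  have injAC: "inj_on fst ?A" "inj_on snd ?A" "inj_on fst ?C" "inj_on snd ?C"
    using K(2,3) N(2,3) inj_on_map_prod_image[of K UNIV UNIV Inl Inl]
      inj_on_map_prod_image[of N UNIV UNIV Inr Inr] by simp_all
  have "inj_on fst (?A \<union> ?B \<union> ?C)"
  proof (intro inj_on_Un_disjoint inj injAC)
    show "fst ` ?A \<inter> fst ` ?B = {}" unfolding fsts by blast
    show "fst ` (?A \<union> ?B) \<inter> fst ` ?C = {}" unfolding image_Un fsts by auto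
  qed
  moreover have "inj_on snd (?A \<union> ?B \<union> ?C)"
  proof (intro inj_on_Un_disjoint inj injAC)
    show "snd ` ?A \<inter> snd ` ?B = {}" unfolding snds by blast
    show "snd ` (?A \<union> ?B) \<inter> snd ` ?C = {}" unfolding image_Un snds by blast
  qed
  moreover have "fst ` (?A \<union> ?B \<union> ?C) = X <+> (V <+> W)"
    unfolding image_Un fsts Plus_def using MV by blast
  moreover have "snd ` (?A \<union> ?B \<union> ?C) = V <+> B"
    unfolding image_Un snds Plus_def using MV by blast
  moreover have "?A \<union> ?B \<union> ?C \<subseteq> comp_edges D V E"
    unfolding comp_edges_def using K(1) N(1) by blast
  ultimately have "matching_onto (comp_edges D V E) ((<+>) V ` \<B>) (X <+> (V <+> W)) (?A \<union> ?B \<union> ?C)"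
    using N(5) by (simp add: matching_onto_def)
  moreover have "sum (comp_weight b c) (?A \<union> ?B \<union> ?C) = sum b K + sum c N"
  proof -
    have "finite (?A \<union> ?B \<union> ?C)"
      using fin finite_subset[OF K(1)] finite_subset[OF N(1)] by simp
    moreover have "{(x, v). (Inl x, Inl v) \<in> ?A \<union> ?B \<union> ?C} = K" by auto
    moreover have "{(l, u). (Inr l, Inr u) \<in> ?A \<union> ?B \<union> ?C} = N" by auto
    ultimately show ?thesis by (simp only: sum_comp_weight)
  qed
  ultimately show ?thesis by blast
qed

lemma comp_matching_converse:
  assumes D: "D \<subseteq> A \<times> V" and E: "E \<subseteq> (V <+> W) \<times> U" and fin: "finite D" "finite V" "finite E"
    and N': "matching_onto (comp_edges D V E) ((<+>) V ` \<B>) (X <+> (V <+> W)) N'"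
  shows "\<exists>K N. matching D K \<and> fst ` K = X \<and> matching_onto E \<B> (snd ` K <+> W) N \<and>
    sum (comp_weight b c) N' = sum b K + sum c N"
proof -
  have N': "N' \<subseteq> comp_edges D V E" "inj_on fst N'" "inj_on snd N'" "fst ` N' = X <+> (V <+> W)"
    "snd ` N' \<in> (<+>) V ` \<B>"
    using N' by (simp_all add: matching_onto_def)
  obtain B where B: "B \<in> \<B>" "snd ` N' = V <+> B" using N'(5) by blast
  define K where "K = {(x, v). (Inl x, Inl v) \<in> N'}"
  define N where "N = {(l, u). (Inr l, Inr u) \<in> N'}"
  have KD: "K \<subseteq> D" and NE: "N \<subseteq> E" using N'(1) by (auto simp: K_def N_def comp_edges_def)
  have out_x: "\<exists>v. y = Inl v \<and> (x, v) \<in> K" if "(Inl x, y) \<in> N'" for x y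
    using that N'(1) by (auto simp: comp_edges_def K_def)
  have out_l: "(\<exists>v. l = Inl v \<and> y = Inl v) \<or> (\<exists>u. y = Inr u \<and> (l, u) \<in> N)" if "(Inr l, y) \<in> N'" for l y
    using that N'(1) by (auto simp: comp_edges_def N_def)
  have in_v: "(\<exists>x. z = Inl x \<and> (x, v) \<in> K) \<or> z = Inr (Inl v)" if "(z, Inl v) \<in> N'" for z v
    using that N'(1) by (auto simp: comp_edges_def K_def)
  have in_u: "\<exists>l. z = Inr l \<and> (l, u) \<in> N" if "(z, Inr u) \<in> N'" for z u
    using that N'(1) by (auto simp: comp_edges_def N_def)
  have "inj_on fst K"
    by (rule inj_onI) (use inj_onD[OF N'(2)] in \<open>fastforce simp: K_def\<close>)
  moreover have "inj_on snd K"
    by (rule inj_onI) (use inj_onD[OF N'(3)] in \<open>fastforce simp: K_def\<close>)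
  ultimately have K: "matching D K" using KD by (simp add: matching_iff_inj_on)
  have injN: "inj_on fst N"
    by (rule inj_onI) (use inj_onD[OF N'(2)] in \<open>fastforce simp: N_def\<close>)
  have injN': "inj_on snd N"
    by (rule inj_onI) (use inj_onD[OF N'(3)] in \<open>fastforce simp: N_def\<close>)
  have "fst ` K = X"
  proof (intro equalityI subsetI)
    fix x assume "x \<in> fst ` K"
    then obtain v where "(Inl x, Inl v) \<in> N'" by (auto simp: K_def)
    then have "Inl x \<in> fst ` N'" by force
    then show "x \<in> X" unfolding N'(4) by auto
  next
    fix x assume "x \<in> X"
    then have "Inl x \<in> fst ` N'" unfolding N'(4) by auto
    then obtain y where "(Inl x, y) \<in> N'" by force
    then show "x \<in> fst ` K" using out_x by force
  qed
  moreover have "fst ` N = snd ` K <+> W"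
  proof (rule Plus_eqI)
    fix v
    show "Inl v \<in> fst ` N \<longleftrightarrow> v \<in> snd ` K"
    proof
      assume "Inl v \<in> fst ` N"
      then obtain u where u: "(Inl v, u) \<in> N" by force
      then have u': "(Inr (Inl v), Inr u) \<in> N'" by (simp add: N_def)
      have "Inl v \<in> V <+> W" using u NE E by blast
      then have "v \<in> V" by auto
      then have "Inl v \<in> snd ` N'" unfolding B(2) by auto
      then obtain z where z: "(z, Inl v) \<in> N'" by force
      have "z \<noteq> Inr (Inl v)" using inj_onD[OF N'(2) _ z u'] by auto
      then show "v \<in> snd ` K" using in_v[OF z] by force
    next
      assume "v \<in> snd ` K"
      then obtain x where x: "(x, v) \<in> K" by force
      then have x': "(Inl x, Inl v) \<in> N'" by (simp add: K_def)
      have "v \<in> V" using x KD D by blast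
      then have "Inr (Inl v) \<in> fst ` N'" unfolding N'(4) by auto
      then obtain y where y: "(Inr (Inl v), y) \<in> N'" by force
      have "y \<noteq> Inl v" using inj_onD[OF N'(3) _ y x'] by auto
      then show "Inl v \<in> fst ` N" using out_l[OF y] by force
    qed
  next
    fix w
    show "Inr w \<in> fst ` N \<longleftrightarrow> w \<in> W"
    proof
      assume "Inr w \<in> fst ` N"
      then obtain u where "(Inr w, u) \<in> N" by force
      then have "Inr w \<in> V <+> W" using NE E by blast
      then show "w \<in> W" by auto
    next
      assume "w \<in> W"
      then have "Inr (Inr w) \<in> fst ` N'" unfolding N'(4) by auto
      then obtain y where y: "(Inr (Inr w), y) \<in> N'" by force
      then show "Inr w \<in> fst ` N" using out_l[OF y] by force
    qed
  qed
  moreover have "snd ` N = B"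
  proof (intro equalityI subsetI)
    fix u assume "u \<in> snd ` N"
    then obtain l where "(Inr l, Inr u) \<in> N'" by (auto simp: N_def)
    then have "Inr u \<in> snd ` N'" by force
    then show "u \<in> B" unfolding B(2) by auto
  next
    fix u assume "u \<in> B"
    then have "Inr u \<in> snd ` N'" unfolding B(2) by auto
    then obtain z where "(z, Inr u) \<in> N'" by force
    then show "u \<in> snd ` N" using in_u by force
  qed
  ultimately have "fst ` K = X" "matching_onto E \<B> (snd ` K <+> W) N"
    using injN injN' NE B(1) by (simp_all add: matching_onto_def)
  moreover have "finite N'"
  proof (rule finite_subset[OF N'(1)])
    show "finite (comp_edges D V E)" using fin by (simp add: comp_edges_def)
  qed
  then have "sum (comp_weight b c) N' = sum b K + sum c N"
    unfolding K_def N_def by (rule sum_comp_weight)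
  ultimately show ?thesis using K by blast
qed

text \<open>
  The right copies of \<open>V\<close> are coloops and the left copies are contracted, so in a matching each \<open>v\<close>
  either is joined to its other copy or is reached along \<open>D\<close> and left along \<open>E\<close>. Hence the matchings
  of the composed graph are pairs of a matching of \<open>D\<close> and a matching of \<open>E\<close> for its endpoints.
\<close>

theorem r_minor_induction:
  fixes D :: "('a \<times> 'b) set"
  assumes f: "r_minor V d f" and A: "finite A" and D: "D \<subseteq> A \<times> V"
    and g: "\<And>X. X \<in> nsets A d \<Longrightarrow>
      g X = (SUP K\<in>{K. matching D K \<and> fst ` K = X}. ereal (sum b K) + f (snd ` K))"
  shows "r_minor A d g"
proof -
  obtain W U :: "nat set" and E c \<B> where R: "represents V d f W U E c \<B>"
    using f unfolding r_minor_iff_represents by blast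
  have fin: "finite V" "finite W" and E: "E \<subseteq> (V <+> W) \<times> U"
    and M: "matroid_with_bases U (d + card W) \<B>"
    using R by (simp_all add: represents_def)
  have finE: "finite E" using represents_finite_edges[OF R] .
  have finD: "finite D" using D A fin(1) by (meson finite_SigmaI finite_subset)
  let ?E = "comp_edges D V E" and ?c = "comp_weight b c" and ?\<B> = "(<+>) V ` \<B>"
  have "represents A d g (V <+> W) (V <+> U) ?E ?c ?\<B>"
    unfolding represents_def
  proof (intro conjI ballI)
    show "?E \<subseteq> (A <+> (V <+> W)) \<times> (V <+> U)"
      using D E by (auto simp: comp_edges_def)
    have "matroid_with_bases (V <+> U) (card V + (d + card W)) {B1 <+> B2 |B1 B2. B1 \<in> {V} \<and> B2 \<in> \<B>}"
      using fin by (intro matroid_with_bases_direct_sum matroid_with_bases_free M)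
    moreover have "{B1 <+> B2 |B1 B2. B1 \<in> {V} \<and> B2 \<in> \<B>} = ?\<B>" by auto
    moreover have "card V + (d + card W) = d + card (V <+> W)" using fin by (simp add: card_Plus)
    ultimately show "matroid_with_bases (V <+> U) (d + card (V <+> W)) ?\<B>" by (simp only:)
    fix X assume X: "X \<in> nsets A d"
    let ?v = "matching_value ?E ?c ?\<B> (X <+> (V <+> W))"
    have ns: "snd ` K \<in> nsets V d" if "matching D K" "fst ` K = X" for K
    proof -
      have K: "K \<subseteq> D" "inj_on fst K" "inj_on snd K" using that(1) by (simp_all add: matching_iff_inj_on)
      have "card (snd ` K) = card (fst ` K)" using card_image[OF K(2)] card_image[OF K(3)] by simp
      moreover have "snd ` K \<subseteq> V" using K(1) D by auto
      ultimately show ?thesis using X fin(1) finite_subset that(2) by (auto simp: nsets_def)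
    qed
    show "g X = ?v"
    proof (rule antisym)
      show "g X \<le> ?v"
        unfolding g[OF X]
      proof (rule SUP_least)
        fix K assume "K \<in> {K. matching D K \<and> fst ` K = X}"
        then have K: "matching D K" "fst ` K = X" by simp_all
        show "ereal (sum b K) + f (snd ` K) \<le> ?v"
        proof (cases "f (snd ` K) = -\<infinity>")
          case False
          then obtain N where N: "matching_onto E \<B> (snd ` K <+> W) N" "f (snd ` K) = ereal (sum c N)"
            using represents_attained[OF R ns[OF K]] by blast
          obtain N' where N': "matching_onto ?E ?\<B> (X <+> (V <+> W)) N'" "sum ?c N' = sum b K + sum c N"
            using comp_matching[OF D finD fin(1) finE K N(1)] by blast
          have "ereal (sum b K) + f (snd ` K) = ereal (sum ?c N')" using N(2) N'(2) by simp
          also have "\<dots> \<le> ?v" using N'(1) by (rule matching_value_upper)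
          finally show ?thesis .
        qed simp
      qed
      show "?v \<le> g X"
        unfolding matching_value_def
      proof (rule SUP_least)
        fix N' assume "N' \<in> {N. matching_onto ?E ?\<B> (X <+> (V <+> W)) N}"
        then have N': "matching_onto ?E ?\<B> (X <+> (V <+> W)) N'" by (rule CollectD)
        obtain K N where K: "matching D K" "fst ` K = X" and N: "matching_onto E \<B> (snd ` K <+> W) N"
          and sum: "sum ?c N' = sum b K + sum c N"
          using comp_matching_converse[OF D E finD fin(1) finE N'] by blast
        have "ereal (sum ?c N') = ereal (sum b K) + ereal (sum c N)" using sum by simp
        also have "\<dots> \<le> ereal (sum b K) + f (snd ` K)"
          using represents_upper[OF R ns[OF K] N] by (rule add_left_mono)
        also have "\<dots> \<le> g X" unfolding g[OF X] using K by (intro SUP_upper) simp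
        finally show "ereal (sum ?c N') \<le> g X" .
      qed
    qed
  qed (use A fin in simp_all)
  then show ?thesis by (rule represents_imp_r_minor)
qed

text \<open>
  Edge weights are real, so an element \<open>v\<close> with \<open>w v = -\<infinity>\<close>, for which \<open>p\<close> can never stand, is left
  without an edge from \<open>p\<close>.
\<close>

definition extension_edges :: "'a set \<Rightarrow> ('a \<Rightarrow> ereal) \<Rightarrow> 'a \<Rightarrow> ('a \<times> 'a) set" where
  "extension_edges V w p = (\<lambda>v. (v, v)) ` V \<union> (\<lambda>v. (p, v)) ` {v \<in> V. w v \<noteq> -\<infinity>}"

definition extension_weight :: "('a \<Rightarrow> ereal) \<Rightarrow> 'a \<Rightarrow> 'a \<times> 'a \<Rightarrow> real" where
  "extension_weight w p = (\<lambda>(x, v). if x = p then real_of_ereal (w v) else 0)"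

lemma extension_matching_diag:
  assumes K: "matching (extension_edges V w p) K" and x: "x \<in> fst ` K" "x \<noteq> p"
  shows "(x, x) \<in> K"
proof -
  obtain v where v: "(x, v) \<in> K" using x(1) by force
  have "K \<subseteq> extension_edges V w p" using K by (simp add: matching_def)
  then have "v = x" using v x(2) by (auto simp: extension_edges_def)
  then show ?thesis using v by simp
qed

lemma extension_matching_avoiding:
  assumes p: "p \<notin> V" "p \<notin> X" and X: "X \<subseteq> V"
  shows "matching (extension_edges V w p) K \<and> fst ` K = X \<longleftrightarrow> K = (\<lambda>v. (v, v)) ` X"
proof
  assume K: "matching (extension_edges V w p) K \<and> fst ` K = X"
  then have inj: "inj_on fst K" by (simp add: matching_iff_inj_on)
  have diag: "(x, x) \<in> K" if "x \<in> X" for x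
    using extension_matching_diag[of V w p K x] K that p(2) by blast
  show "K = (\<lambda>v. (v, v)) ` X"
  proof (intro equalityI subsetI)
    fix e assume e: "e \<in> K"
    then have "fst e \<in> X" using K by blast
    then have "e = (fst e, fst e)" using inj_onD[OF inj _ e diag] by simp
    then show "e \<in> (\<lambda>v. (v, v)) ` X" using \<open>fst e \<in> X\<close> by blast
  qed (use diag in blast)
next
  assume K: "K = (\<lambda>v. (v, v)) ` X"
  have "inj_on fst K" "inj_on snd K" "fst ` K = X" unfolding K by (auto simp: inj_on_def image_image)
  then show "matching (extension_edges V w p) K \<and> fst ` K = X"
    using X unfolding matching_iff_inj_on by (auto simp: K extension_edges_def)
qed

lemma extension_matching_using:
  assumes p: "p \<notin> V" "p \<in> X" and X: "X \<subseteq> insert p V"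
  shows "matching (extension_edges V w p) K \<and> fst ` K = X \<longleftrightarrow>
    (\<exists>v\<in>V - (X - {p}). w v \<noteq> -\<infinity> \<and> K = insert (p, v) ((\<lambda>x. (x, x)) ` (X - {p})))"
proof
  assume K: "matching (extension_edges V w p) K \<and> fst ` K = X"
  then have inj: "inj_on fst K" "inj_on snd K" and sub: "K \<subseteq> extension_edges V w p"
    by (simp_all add: matching_iff_inj_on)
  have diag: "(x, x) \<in> K" if "x \<in> X - {p}" for x
    using extension_matching_diag[of V w p K x] K that by blast
  have "p \<in> fst ` K" using K p(2) by simp
  then obtain v where v: "(p, v) \<in> K" by force
  then have vV: "v \<in> V" "w v \<noteq> -\<infinity>" using sub p(1) by (auto simp: extension_edges_def)
  have "v \<notin> X - {p}"
  proof
    assume "v \<in> X - {p}"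
    then show False using inj_onD[OF inj(2) _ v diag] by auto
  qed
  moreover have "K = insert (p, v) ((\<lambda>x. (x, x)) ` (X - {p}))"
  proof (intro equalityI subsetI)
    fix e assume e: "e \<in> K"
    then have eX: "fst e \<in> X" using K by blast
    show "e \<in> insert (p, v) ((\<lambda>x. (x, x)) ` (X - {p}))"
    proof (cases "fst e = p")
      case True
      then show ?thesis using inj_onD[OF inj(1) _ e v] by simp
    next
      case False
      then have "e = (fst e, fst e)" using inj_onD[OF inj(1) _ e diag] eX by simp
      then show ?thesis using eX False by blast
    qed
  qed (use diag v in blast)
  ultimately show "\<exists>v\<in>V - (X - {p}). w v \<noteq> -\<infinity> \<and> K = insert (p, v) ((\<lambda>x. (x, x)) ` (X - {p}))"
    using vV by blast
next
  assume "\<exists>v\<in>V - (X - {p}). w v \<noteq> -\<infinity> \<and> K = insert (p, v) ((\<lambda>x. (x, x)) ` (X - {p}))"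
  then obtain v where v: "v \<in> V" "v \<notin> X - {p}" "w v \<noteq> -\<infinity>"
    and K: "K = insert (p, v) ((\<lambda>x. (x, x)) ` (X - {p}))" by blast
  have "inj_on fst K" "inj_on snd K" unfolding K using v(2) by (auto simp: inj_on_def)
  moreover have "fst ` K = X" unfolding K using p(2) by (auto simp: image_image)
  moreover have "K \<subseteq> extension_edges V w p"
    unfolding K extension_edges_def using X v by blast
  ultimately show "matching (extension_edges V w p) K \<and> fst ` K = X"
    by (simp add: matching_iff_inj_on)
qed

lemma r_minor_principal_extension:
  assumes f: "r_minor V d f" and w: "\<And>v. v \<in> V \<Longrightarrow> w v \<noteq> \<infinity>" and p: "p \<notin> V"
  shows "r_minor (insert p V) d (principal_extension V f w p)"
proof (rule r_minor_induction[OF f])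
  let ?D = "extension_edges V w p" and ?b = "extension_weight w p"
  have finV: "finite V" using f by (simp add: r_minor_def)
  then show "finite (insert p V)" by simp
  show "?D \<subseteq> insert p V \<times> V" by (auto simp: extension_edges_def)
  fix X assume "X \<in> nsets (insert p V) d"
  then have X: "X \<subseteq> insert p V" "finite X" "card X = d" by (simp_all add: nsets_def)
  show "principal_extension V f w p X =
      (SUP K\<in>{K. matching ?D K \<and> fst ` K = X}. ereal (sum ?b K) + f (snd ` K))"
  proof (cases "p \<in> X")
    case False
    then have "X \<subseteq> V" using X(1) by blast
    then have "{K. matching ?D K \<and> fst ` K = X} = {(\<lambda>v. (v, v)) ` X}"
      using extension_matching_avoiding[OF p False] by simp
    moreover have "sum ?b ((\<lambda>v. (v, v)) ` X) = 0"
      by (rule sum.neutral) (use False in \<open>auto simp: extension_weight_def\<close>)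
    moreover have "snd ` (\<lambda>v. (v, v)) ` X = X" by (simp add: image_image)
    ultimately show ?thesis using False by (simp add: principal_extension_def)
  next
    case True
    let ?X = "X - {p}"
    let ?K = "\<lambda>v. insert (p, v) ((\<lambda>x. (x, x)) ` ?X)"
    have XV: "?X \<subseteq> V" using X(1) by blast
    have val: "ereal (sum ?b (?K v)) + f (snd ` ?K v) = f (insert v ?X) + w v"
      if "v \<in> V" "w v \<noteq> -\<infinity>" for v
    proof -
      have "sum ?b (?K v) = ?b (p, v) + sum ?b ((\<lambda>x. (x, x)) ` ?X)"
        using X(2) by (intro sum.insert) auto
      also have "sum ?b ((\<lambda>x. (x, x)) ` ?X) = 0"
        by (rule sum.neutral) (auto simp: extension_weight_def)
      also have "?b (p, v) + 0 = real_of_ereal (w v)" by (simp add: extension_weight_def)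
      finally have sum: "sum ?b (?K v) = real_of_ereal (w v)" .
      have "ereal (real_of_ereal (w v)) = w v"
        using w[OF that(1)] that(2) by (cases "w v") simp_all
      then have "ereal (sum ?b (?K v)) = w v" unfolding sum .
      moreover have "snd ` ?K v = insert v ?X" by (simp add: image_image)
      ultimately show ?thesis by (simp only: add.commute)
    qed
    have fK: "f (insert v ?X) \<noteq> \<infinity>" if "v \<in> V - ?X" for v
    proof -
      have "card (insert v ?X) = Suc (card ?X)" using that X(2) by simp
      also have "\<dots> = d" using card_Suc_Diff1[OF X(2) True] X(3) by simp
      finally have "insert v ?X \<in> nsets V d" using that XV X(2) by (simp add: nsets_def)
      then show ?thesis
        using r_minor_valuated_matroid[OF f] by (simp add: valuated_matroid_def)
    qed
    have "(SUP v\<in>V - ?X. f (insert v ?X) + w v) =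
        (SUP K\<in>{K. matching ?D K \<and> fst ` K = X}. ereal (sum ?b K) + f (snd ` K))"
    proof (rule antisym; rule SUP_least)
      fix v assume v: "v \<in> V - ?X"
      show "f (insert v ?X) + w v \<le>
          (SUP K\<in>{K. matching ?D K \<and> fst ` K = X}. ereal (sum ?b K) + f (snd ` K))"
      proof (cases "w v = -\<infinity>")
        case True
        then have eq: "f (insert v ?X) + w v = -\<infinity>" using fK[OF v] by simp
        show ?thesis unfolding eq bot_ereal_def[symmetric] by (rule bot_least)
      next
        case False
        then have "\<exists>v'\<in>V - ?X. w v' \<noteq> -\<infinity> \<and> ?K v = ?K v'" using v by (intro bexI[of _ v] conjI refl)
        then have "?K v \<in> {K. matching ?D K \<and> fst ` K = X}"
          unfolding mem_Collect_eq extension_matching_using[OF p True X(1)] .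
        then have "ereal (sum ?b (?K v)) + f (snd ` ?K v) \<le>
            (SUP K\<in>{K. matching ?D K \<and> fst ` K = X}. ereal (sum ?b K) + f (snd ` K))"
          by (rule SUP_upper)
        then show ?thesis using val[OF _ False] v by (simp only: Diff_iff)
      qed
    next
      fix K assume "K \<in> {K. matching ?D K \<and> fst ` K = X}"
      then obtain v where v: "v \<in> V - ?X" "w v \<noteq> -\<infinity>" "K = ?K v"
        unfolding mem_Collect_eq extension_matching_using[OF p True X(1)] by blast
      have "ereal (sum ?b K) + f (snd ` K) = f (insert v ?X) + w v"
        unfolding v(3) using v(1,2) by (intro val) simp_all
      also have "\<dots> \<le> (SUP v\<in>V - ?X. f (insert v ?X) + w v)" using v(1) by (rule SUP_upper)
      finally show "ereal (sum ?b K) + f (snd ` K) \<le> (SUP v\<in>V - ?X. f (insert v ?X) + w v)" .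
    qed
    then show ?thesis unfolding principal_extension_def if_P[OF True] .
  qed
qed

theorem theorem3p11:
  shows "complete_class (r_minor :: 'a set \<Rightarrow> nat \<Rightarrow> ('a set \<Rightarrow> ereal) \<Rightarrow> bool)"  unfolding complete_class_def
proof (intro conjI allI impI)
  fix V :: "'a set" and d f
  show "valuated_matroid V d f" if "r_minor V d f"
    using that by (rule r_minor_valuated_matroid)
  show "r_minor (V - Y) d (vm_restriction V d f Y)" if "r_minor V d f \<and> Y \<subseteq> V" for Y
    using conjunct1[OF that] by (rule r_minor_restriction)
  show "r_minor V (card V - d) (vm_dual V f)" if "r_minor V d f \<and> d \<le> card V"
    using conjunct1[OF that] conjunct2[OF that] by (rule r_minor_dual)
  show "r_minor (insert p V) d (principal_extension V f w p)"
    if "r_minor V d f \<and> (\<forall>v\<in>V. w v \<noteq> \<infinity>) \<and> p \<notin> V" for w p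
    using that by (intro r_minor_principal_extension) simp_all
next
  fix V1 :: "'a set" and d1 f1 and V2 :: "'a set" and d2 f2
  assume "r_minor V1 d1 f1 \<and> r_minor V2 d2 f2 \<and> V1 \<inter> V2 = {}"
  then show "r_minor (V1 \<union> V2) (d1 + d2) (vm_direct_sum V1 d1 f1 V2 d2 f2)"
    by (intro r_minor_direct_sum) simp_all
qed

end
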